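(* Let $(\mathbf A_n)_{n\in\mathbb N}$ be a sequence of finite graphs of uniformly bounded degree (i.e. there is $D$ such that every vertex of every $\mathbf A_n$ has degree at most $D$). Then the following conditions are equivalent: (1) the sequence $(\mathbf A_n)_{n\in\mathbb N}$ is strongly polynomial; (2) there is a finite set $\{\mathbf F_1,\dots,\mathbf F_k\}$ of graphs and polynomials $P_1,\dots,P_k$ such that for every $n\in\mathbb N$, $\mathbf A_n$ is (isomorphic to) the disjoint union $\sum_{i=1}^k P_i(n)\,\mathbf F_i$, where $P_i(n)\,\mathbf F_i$ denotes the disjoint union of $P_i(n)$ copies of $\mathbf F_i$; (3) the sequence $(\mathbf A_n)_{n\in\mathbb N}$ is a QF-interpretation of a basic sequence, i.e. there exist integers $k,\ell$, a basic sequence $(\mathbf B_n)_{n\in\mathbb N}$ of structures in $\mathcal B_{k,\ell}$ and a QF-interpretation scheme $I$ of graphs in $\beta_{k,\ell}$-structures such that $\mathbf A_n$ is isomorphic to $I(\mathbf B_n)$ for every $n\in\mathbb N$.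
   Context: Graphs are viewed as relational structures with a single symmetric irreflexive binary relation (adjacency). A signature $\lambda$ is a finite set of relation symbols, each with an arity; a $\lambda$-structure $\mathbf A$ consists of a finite domain $A$ and, for each $R\in\lambda$ of arity $r$, a relation $R^{\mathbf A}\subseteq A^r$. For a first-order formula $\phi$ over $\lambda$ (first-order logic with equality) with exactly $p$ free variables $x_1,\dots,x_p$, let $\phi(\mathbf A)=\{(v_1,\dots,v_p)\in A^p:\mathbf A\models\phi(v_1,\dots,v_p)\}$. A sequence $(\mathbf A_n)_{n\in\mathbb N}$ of $\lambda$-structures is strongly polynomial if for every quantifier-free formula $\phi$ there is a polynomial $P_\phi$ with $|\phi(\mathbf A_n)|=P_\phi(n)$ for all $n\in\mathbb N$. Interpretation scheme: if $\lambda$ has relation symbols $R_1,\dots,R_q$ of arities $r_1,\dots,r_q$, an interpretation scheme of $\lambda$-structures in $\kappa$-structures with exponent $p$ is a tuple $I=(p,\rho_0,\dots,\rho_q)$ where $\rho_0$ is a first-order $\kappa$-formula with $p$ free variables and $\rho_i$ a first-order $\kappa$-formula with $pr_i$ free variables; $I(\mathbf A)$ is the $\lambda$-structure with domain $\rho_0(\mathbf A)\subseteq A^p$ in which $R_i(\mathbf v_1,\dots,\mathbf v_{r_i})$ holds iff $\mathbf A\models\rho_i(\mathbf v_1,\dots,\mathbf v_{r_i})$. It is a QF-interpretation scheme if all $\rho_i$ are quantifier-free. Strong sum: for a $\kappa$-structure $\mathbf A$ and $\lambda$-structure $\mathbf B$, $\mathbf A\oplus\mathbf B$ is the structure with signature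 the disjoint union $\kappa\sqcup\lambda$, domain the disjoint union $A\sqcup B$, in which each $R\in\kappa$ holds exactly on the tuples of $A$ on which it holds in $\mathbf A$, and each $S\in\lambda$ holds exactly on the tuples of $B$ on which it holds in $\mathbf B$. Basic structures: $\mathbf E$ is the structure with a one-element domain and one unary relation $U$ true on that element. $\mathbf T_N$ has domain $\{1,\dots,N\}$, a binary relation $S$ with $S(i,j)\iff i<j$, and a unary relation $U$ true on all elements. A basic structure with parameters $(k,\ell)$ is $\mathbf E\oplus\dots\oplus\mathbf E\oplus\mathbf T_{N_1}\oplus\dots\oplus\mathbf T_{N_k}$ ($\ell$ copies of $\mathbf E$) for some $N_1,\dots,N_k$; $\mathcal B_{k,\ell}$ is the class of these, and $\beta_{k,\ell}$ their signature, with relations $U^E_1,\dots,U^E_\ell$ (marking the copies of $\mathbf E$), $U^T_1,\dots,U^T_k$ (marking the tournaments) and $S_1,\dots,S_k$ (the orders on the tournaments). A basic sequence is a sequence $(\mathbf B_n)$ of structures in $\mathcal B_{k,\ell}$ (fixed $k,\ell$) for which there are non-constant polynomials $Q_1,\dots,Q_k$ with $N_i(\mathbf B_n)=Q_i(n)$ for all $i$ and $n$. *)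

theory Defs
  imports Complex_Main "HOL-Computational_Algebra.Polynomial"
begin

section \<open>Relational structures\<close>

record 's signature =
  symbols :: "'s set"
  arity :: "'s \<Rightarrow> nat"

text \<open>Tuples are lists. The interpretation of a symbol that does not belong to the signature
  under consideration is irrelevant. Domains may be empty.\<close>

record ('s, 'a) rstruct =
  univ :: "'a set"
  rels :: "'s \<Rightarrow> 'a list set"

definition is_struct :: "'s signature \<Rightarrow> ('s, 'a) rstruct \<Rightarrow> bool" where
  "is_struct \<sigma> A \<longleftrightarrow> finite (symbols \<sigma>) \<and> finite (univ A) \<and>
     (\<forall>R\<in>symbols \<sigma>. rels A R \<subseteq> {v. length v = arity \<sigma> R \<and> set v \<subseteq> univ A})"

definition isomorphic :: "'s signature \<Rightarrow> ('s, 'a) rstruct \<Rightarrow> ('s, 'b) rstruct \<Rightarrow> bool" where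
  "isomorphic \<sigma> A B \<longleftrightarrow> (\<exists>f. bij_betw f (univ A) (univ B) \<and>
     (\<forall>R\<in>symbols \<sigma>. \<forall>v. length v = arity \<sigma> R \<and> set v \<subseteq> univ A \<longrightarrow>
        (v \<in> rels A R \<longleftrightarrow> map f v \<in> rels B R)))"

section \<open>First-order formulas with equality\<close>

datatype 's fm =
    Bot
  | Atom 's "nat list"
  | Eq nat nat
  | Neg "'s fm"
  | Conj "'s fm" "'s fm"
  | Ex nat "'s fm"

primrec wf_fm :: "'s signature \<Rightarrow> 's fm \<Rightarrow> bool" where
  "wf_fm \<sigma> Bot \<longleftrightarrow> True"
| "wf_fm \<sigma> (Atom R xs) \<longleftrightarrow> R \<in> symbols \<sigma> \<and> length xs = arity \<sigma> R"
| "wf_fm \<sigma> (Eq x y) \<longleftrightarrow> True"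
| "wf_fm \<sigma> (Neg \<phi>) \<longleftrightarrow> wf_fm \<sigma> \<phi>"
| "wf_fm \<sigma> (Conj \<phi> \<psi>) \<longleftrightarrow> wf_fm \<sigma> \<phi> \<and> wf_fm \<sigma> \<psi>"
| "wf_fm \<sigma> (Ex x \<phi>) \<longleftrightarrow> wf_fm \<sigma> \<phi>"

primrec free_vars :: "'s fm \<Rightarrow> nat set" where
  "free_vars Bot = {}"
| "free_vars (Atom R xs) = set xs"
| "free_vars (Eq x y) = {x, y}"
| "free_vars (Neg \<phi>) = free_vars \<phi>"
| "free_vars (Conj \<phi> \<psi>) = free_vars \<phi> \<union> free_vars \<psi>"
| "free_vars (Ex x \<phi>) = free_vars \<phi> - {x}"

primrec quantifier_free :: "'s fm \<Rightarrow> bool" where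
  "quantifier_free Bot \<longleftrightarrow> True"
| "quantifier_free (Atom R xs) \<longleftrightarrow> True"
| "quantifier_free (Eq x y) \<longleftrightarrow> True"
| "quantifier_free (Neg \<phi>) \<longleftrightarrow> quantifier_free \<phi>"
| "quantifier_free (Conj \<phi> \<psi>) \<longleftrightarrow> quantifier_free \<phi> \<and> quantifier_free \<psi>"
| "quantifier_free (Ex x \<phi>) \<longleftrightarrow> False"

primrec sat :: "('s, 'a) rstruct \<Rightarrow> (nat \<Rightarrow> 'a) \<Rightarrow> 's fm \<Rightarrow> bool" where
  "sat A e Bot \<longleftrightarrow> False"
| "sat A e (Atom R xs) \<longleftrightarrow> map e xs \<in> rels A R"
| "sat A e (Eq x y) \<longleftrightarrow> e x = e y"
| "sat A e (Neg \<phi>) \<longleftrightarrow> \<not> sat A e \<phi>"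
| "sat A e (Conj \<phi> \<psi>) \<longleftrightarrow> sat A e \<phi> \<and> sat A e \<psi>"
| "sat A e (Ex x \<phi>) \<longleftrightarrow> (\<exists>a\<in>univ A. sat A (e(x := a)) \<phi>)"

text \<open>A \<open>\<sigma>\<close>-formula with exactly \<open>p\<close> free variables; these are numbered \<open>0, \<dots>, p - 1\<close>.\<close>

definition formula :: "'s signature \<Rightarrow> nat \<Rightarrow> 's fm \<Rightarrow> bool" where
  "formula \<sigma> p \<phi> \<longleftrightarrow> wf_fm \<sigma> \<phi> \<and> free_vars \<phi> = {..<p}"

definition holds_at :: "('s, 'a) rstruct \<Rightarrow> 's fm \<Rightarrow> 'a list \<Rightarrow> bool" where
  "holds_at A \<phi> v \<longleftrightarrow> sat A (\<lambda>i. v ! i) \<phi>"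

definition answers :: "nat \<Rightarrow> 's fm \<Rightarrow> ('s, 'a) rstruct \<Rightarrow> 'a list set" where
  "answers p \<phi> A = {v. length v = p \<and> set v \<subseteq> univ A \<and> holds_at A \<phi> v}"

text \<open>Polynomials are taken over the rationals: a real or complex polynomial with integer values
  on the natural numbers has rational coefficients.\<close>

definition strongly_polynomial :: "'s signature \<Rightarrow> (nat \<Rightarrow> ('s, 'a) rstruct) \<Rightarrow> bool" where
  "strongly_polynomial \<sigma> A \<longleftrightarrow> (\<forall>n. is_struct \<sigma> (A n)) \<and>
     (\<forall>p \<phi>. formula \<sigma> p \<phi> \<and> quantifier_free \<phi> \<longrightarrow>
        (\<exists>P :: rat poly. \<forall>n. of_nat (card (answers p \<phi> (A n))) = poly P (of_nat n)))"

section \<open>Interpretation schemes\<close>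

record ('s, 't) scheme =
  exponent :: nat
  dom_fm :: "'s fm"
  rel_fm :: "'t \<Rightarrow> 's fm"

definition interp_scheme ::
  "'t signature \<Rightarrow> 's signature \<Rightarrow> ('s, 't) scheme \<Rightarrow> bool" where
  "interp_scheme \<tau> \<kappa> I \<longleftrightarrow> formula \<kappa> (exponent I) (dom_fm I) \<and>
     (\<forall>R\<in>symbols \<tau>. formula \<kappa> (exponent I * arity \<tau> R) (rel_fm I R))"

definition qf_interp_scheme ::
  "'t signature \<Rightarrow> 's signature \<Rightarrow> ('s, 't) scheme \<Rightarrow> bool" where
  "qf_interp_scheme \<tau> \<kappa> I \<longleftrightarrow> interp_scheme \<tau> \<kappa> I \<and> quantifier_free (dom_fm I) \<and>
     (\<forall>R\<in>symbols \<tau>. quantifier_free (rel_fm I R))"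

definition interpret_struct ::
  "'t signature \<Rightarrow> ('s, 't) scheme \<Rightarrow> ('s, 'a) rstruct \<Rightarrow> ('t, 'a list) rstruct" where
  "interpret_struct \<tau> I A = \<lparr>
     univ = answers (exponent I) (dom_fm I) A,
     rels = (\<lambda>R. {vs. length vs = arity \<tau> R \<and>
                     set vs \<subseteq> answers (exponent I) (dom_fm I) A \<and>
                     holds_at A (rel_fm I R) (concat vs)})\<rparr>"

section \<open>Strong sums and basic sequences\<close>

text \<open>Strong sum of a family of structures: the disjoint unions of the signatures and of the
  domains are both formed by tagging with the index of the summand.\<close>

definition sig_sum :: "'i set \<Rightarrow> ('i \<Rightarrow> 's signature) \<Rightarrow> ('i \<times> 's) signature" where
  "sig_sum J \<sigma> = \<lparr>symbols = (SIGMA i:J. symbols (\<sigma> i)), arity = (\<lambda>(i, R). arity (\<sigma> i) R)\<rparr>"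

definition strong_sum :: "'i set \<Rightarrow> ('i \<Rightarrow> ('s, 'a) rstruct) \<Rightarrow> ('i \<times> 's, 'i \<times> 'a) rstruct" where
  "strong_sum J A = \<lparr>univ = (SIGMA i:J. univ (A i)),
     rels = (\<lambda>(i, R). map (Pair i) ` rels (A i) R)\<rparr>"

datatype basic_sym = USym | SSym

fun basic_arity :: "basic_sym \<Rightarrow> nat" where
  "basic_arity USym = 1"
| "basic_arity SSym = 2"

definition E_sig :: "basic_sym signature" where
  "E_sig = \<lparr>symbols = {USym}, arity = basic_arity\<rparr>"

definition T_sig :: "basic_sym signature" where
  "T_sig = \<lparr>symbols = {USym, SSym}, arity = basic_arity\<rparr>"

definition E_struct :: "(basic_sym, nat) rstruct" where
  "E_struct = \<lparr>univ = {1}, rels = (\<lambda>R. case R of USym \<Rightarrow> {[1]} | SSym \<Rightarrow> {})\<rparr>"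

definition T_struct :: "nat \<Rightarrow> (basic_sym, nat) rstruct" where
  "T_struct N = \<lparr>univ = {1..N},
     rels = (\<lambda>R. case R of USym \<Rightarrow> {[i] | i. i \<in> {1..N}}
                       | SSym \<Rightarrow> {[i, j] | i j. i \<in> {1..N} \<and> j \<in> {1..N} \<and> i < j})\<rparr>"

datatype part = E_part nat | T_part nat

definition parts :: "nat \<Rightarrow> nat \<Rightarrow> part set" where
  "parts k l = E_part ` {..<l} \<union> T_part ` {..<k}"

text \<open>With indices starting at \<open>0\<close>, the symbols \<open>(E_part i, USym)\<close>, \<open>(T_part j, USym)\<close>, \<open>(T_part j, SSym)\<close>
  are the relations marking the \<open>i\<close>-th copy of \<open>E\<close>, marking the \<open>j\<close>-th tournament, and ordering
  the \<open>j\<close>-th tournament, respectively.\<close>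

definition basic_sig :: "nat \<Rightarrow> nat \<Rightarrow> (part \<times> basic_sym) signature" where
  "basic_sig k l =
     sig_sum (parts k l) (\<lambda>q. case q of E_part i \<Rightarrow> E_sig | T_part j \<Rightarrow> T_sig)"

definition basic_struct ::
  "nat \<Rightarrow> nat \<Rightarrow> (nat \<Rightarrow> nat) \<Rightarrow> (part \<times> basic_sym, part \<times> nat) rstruct" where
  "basic_struct k l N =
     strong_sum (parts k l) (\<lambda>q. case q of E_part i \<Rightarrow> E_struct | T_part j \<Rightarrow> T_struct (N j))"

definition basic_sequence ::
  "nat \<Rightarrow> nat \<Rightarrow> (nat \<Rightarrow> (part \<times> basic_sym, part \<times> nat) rstruct) \<Rightarrow> bool" where
  "basic_sequence k l B \<longleftrightarrow>
     (\<exists>(N :: nat \<Rightarrow> nat \<Rightarrow> nat) (Q :: nat \<Rightarrow> rat poly).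
        (\<forall>n. B n = basic_struct k l (N n)) \<and>
        (\<forall>i<k. degree (Q i) > 0 \<and> (\<forall>n. of_nat (N n i) = poly (Q i) (of_nat n))))"

section \<open>Graphs\<close>

datatype graph_sym = Adj

definition graph_sig :: "graph_sym signature" where
  "graph_sig = \<lparr>symbols = {Adj}, arity = (\<lambda>_. 2)\<rparr>"

type_synonym 'a graph = "(graph_sym, 'a) rstruct"

definition adjacent :: "'a graph \<Rightarrow> 'a \<Rightarrow> 'a \<Rightarrow> bool" where
  "adjacent G u v \<longleftrightarrow> [u, v] \<in> rels G Adj"

definition is_graph :: "'a graph \<Rightarrow> bool" where
  "is_graph G \<longleftrightarrow> is_struct graph_sig G \<and>
     (\<forall>u v. adjacent G u v \<longrightarrow> adjacent G v u) \<and> (\<forall>u. \<not> adjacent G u u)"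

definition vertex_degree :: "'a graph \<Rightarrow> 'a \<Rightarrow> nat" where
  "vertex_degree G v = card {w \<in> univ G. adjacent G v w}"

definition bounded_degree_seq :: "(nat \<Rightarrow> 'a graph) \<Rightarrow> bool" where
  "bounded_degree_seq A \<longleftrightarrow> (\<exists>D. \<forall>n. \<forall>v\<in>univ (A n). vertex_degree (A n) v \<le> D)"

text \<open>Unlike in the strong sum, the summands share their signature here.\<close>

definition disjoint_union :: "'i set \<Rightarrow> ('i \<Rightarrow> ('s, 'a) rstruct) \<Rightarrow> ('s, 'i \<times> 'a) rstruct" where
  "disjoint_union J A = \<lparr>univ = (SIGMA i:J. univ (A i)),
     rels = (\<lambda>R. \<Union>i\<in>J. map (Pair i) ` rels (A i) R)\<rparr>"

definition copies :: "nat \<Rightarrow> ('s, 'a) rstruct \<Rightarrow> ('s, nat \<times> 'a) rstruct" where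
  "copies m F = disjoint_union {..<m} (\<lambda>_. F)"

text \<open>The values \<open>P i (n)\<close> have to be natural numbers; \<open>m i n\<close> is that number. Since the graphs
  \<open>F i\<close> are finite, there is no loss of generality in taking their vertices in \<open>nat\<close>.\<close>

definition polynomial_disjoint_union :: "(nat \<Rightarrow> 'a graph) \<Rightarrow> bool" where
  "polynomial_disjoint_union A \<longleftrightarrow>
     (\<exists>(k :: nat) (F :: nat \<Rightarrow> nat graph) (P :: nat \<Rightarrow> rat poly) (m :: nat \<Rightarrow> nat \<Rightarrow> nat).
        (\<forall>i<k. is_graph (F i)) \<and>
        (\<forall>i<k. \<forall>n. of_nat (m i n) = poly (P i) (of_nat n)) \<and>
        (\<forall>n. isomorphic graph_sig (A n) (disjoint_union {..<k} (\<lambda>i. copies (m i n) (F i)))))"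

definition qf_interpretation_of_basic_sequence :: "(nat \<Rightarrow> 'a graph) \<Rightarrow> bool" where
  "qf_interpretation_of_basic_sequence A \<longleftrightarrow>
     (\<exists>k l B I. basic_sequence k l B \<and> qf_interp_scheme graph_sig (basic_sig k l) I \<and>
        (\<forall>n. isomorphic graph_sig (A n) (interpret_struct graph_sig I (B n))))"

section \<open>Consistency checks\<close>

lemma is_struct_basic: "is_struct (basic_sig k l) (basic_struct k l N)"
  by (auto simp: is_struct_def basic_sig_def basic_struct_def sig_sum_def strong_sum_def parts_def
      E_sig_def T_sig_def E_struct_def T_struct_def split: part.splits)

lemma is_struct_interpret:
  assumes "finite (symbols \<tau>)" "finite (univ A)"
  shows "is_struct \<tau> (interpret_struct \<tau> I A)"
proof -
  have "finite (answers p \<phi> A)" for p \<phi>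
    by (rule finite_subset[OF _ finite_lists_length_eq[OF assms(2), of p]])
      (auto simp: answers_def)
  then show ?thesis
    using assms(1) by (auto simp: is_struct_def interpret_struct_def)
qed

lemma is_graph_disjoint_union:
  assumes "finite J" "\<And>i. i \<in> J \<Longrightarrow> is_graph (G i)"
  shows "is_graph (disjoint_union J G)"
  using assms
  by (fastforce simp: is_graph_def is_struct_def graph_sig_def adjacent_def disjoint_union_def
      Cons_eq_map_conv image_iff)

end

theory Submission
  imports Defs "HOL-Library.FuncSet" "HOL-Library.Nat_Bijection"
begin

text \<open>
  (1) implies (2): call a list a tree list if its entries are distinct and each but the first is
  adjacent to an earlier one. For each length \<open>r\<close> the number of tree lists is a polynomial in \<open>n\<close>,
  and bounded degree makes it at most a constant times the number of vertices, so its degree is at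
  most some \<open>d\<close> independent of \<open>r\<close>. If \<open>r\<close> exceeds the order of the first \<open>d + 1\<close> graphs, the polynomial
  has \<open>d + 1\<close> zeros and vanishes; hence the components have bounded size. A tree list enumerates
  a component if and only if it has no outside neighbour, which is not quantifier-free; but as
  the number of outside neighbours is bounded, inclusion-exclusion expresses the number of such
  lists of a given isomorphism type by counts of quantifier-free formulas. Each component
  of that type has the same number of enumerations.

  (2) implies (3): a vertex is a pair consisting of a point of a basic structure, which selects the
  copy, and of a one-element part, which selects the vertex in the copy.

  (3) implies (1): group the answers by the sets \<open>X\<^sub>j\<close> of points that they use in the \<open>j\<close>-th
  tournament. Their number depends only on the cardinalities \<open>s\<^sub>j\<close> of the sets \<open>X\<^sub>j\<close>, because order
  embeddings preserve quantifier-free formulas. So the number of answers is a finite sum of products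
  of binomial coefficients \<open>N\<^sub>j choose s\<^sub>j\<close>.
\<close>

section \<open>Embeddings and quantifier-free formulas\<close>

text \<open>An isomorphism onto an induced substructure. Surjectivity is left out because small
  basic structures are to be placed inside larger ones.\<close>

definition embeds :: "'s signature \<Rightarrow> ('a \<Rightarrow> 'b) \<Rightarrow> ('s, 'a) rstruct \<Rightarrow> ('s, 'b) rstruct \<Rightarrow> bool" where
  "embeds \<sigma> h A B \<longleftrightarrow> inj_on h (univ A) \<and> h ` univ A \<subseteq> univ B \<and>
     (\<forall>R\<in>symbols \<sigma>. \<forall>v. length v = arity \<sigma> R \<and> set v \<subseteq> univ A \<longrightarrow>
        (v \<in> rels A R \<longleftrightarrow> map h v \<in> rels B R))"

lemma sat_cong:
  assumes "quantifier_free \<phi>" "\<And>x. x \<in> free_vars \<phi> \<Longrightarrow> e x = e' x"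
  shows "sat A e \<phi> \<longleftrightarrow> sat A e' \<phi>"
  using assms
proof (induction \<phi>)
  case (Atom R xs)
  then have "map e xs = map e' xs" by simp
  then show ?case by (simp only: sat.simps)
qed auto

text \<open>Without quantifiers, truth depends only on the points assigned to the variables, so
  points of \<open>B\<close> outside the image of \<open>h\<close> have no influence. Injectivity
  settles the equations.\<close>

lemma sat_embeds:
  assumes "embeds \<sigma> h A B" "quantifier_free \<phi>" "wf_fm \<sigma> \<phi>" "e ` free_vars \<phi> \<subseteq> univ A"
  shows "sat B (h \<circ> e) \<phi> \<longleftrightarrow> sat A e \<phi>"
  using assms(2-4)
proof (induction \<phi>)
  case (Atom R xs)
  then have "length (map e xs) = arity \<sigma> R \<and> set (map e xs) \<subseteq> univ A" "R \<in> symbols \<sigma>"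
    by auto
  then have "map e xs \<in> rels A R \<longleftrightarrow> map h (map e xs) \<in> rels B R"
    using assms(1) unfolding embeds_def by blast
  then show ?case by (simp add: comp_def)
next
  case (Eq x y)
  then show ?case using assms(1) by (auto simp: embeds_def inj_on_def)
qed auto

lemma holds_at_map:
  assumes "embeds \<sigma> h A B" "formula \<sigma> p \<phi>" "quantifier_free \<phi>" "length v = p" "set v \<subseteq> univ A"
  shows "holds_at B \<phi> (map h v) \<longleftrightarrow> holds_at A \<phi> v"
proof -
  have "sat B (\<lambda>i. map h v ! i) \<phi> \<longleftrightarrow> sat B (h \<circ> (\<lambda>i. v ! i)) \<phi>"
    using assms by (intro sat_cong) (auto simp: formula_def)
  also have "\<dots> \<longleftrightarrow> sat A (\<lambda>i. v ! i) \<phi>"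
    using assms by (intro sat_embeds) (auto simp: formula_def)
  finally show ?thesis by (simp add: holds_at_def)
qed

lemma map_in_answers_iff:
  assumes "embeds \<sigma> h A B" "formula \<sigma> p \<phi>" "quantifier_free \<phi>" "set v \<subseteq> univ A"
  shows "map h v \<in> answers p \<phi> B \<longleftrightarrow> v \<in> answers p \<phi> A"
proof (cases "length v = p")
  case True
  have "h ` set v \<subseteq> univ B" using assms(1,4) by (auto simp: embeds_def)
  then show ?thesis
    using True assms(4) holds_at_map[OF assms(1-3) True assms(4)] by (auto simp: answers_def)
qed (auto simp: answers_def)

text \<open>Quantifier-free interpretations are functorial for embeddings: membership in the domain
  and in each relation is decided by a quantifier-free formula on the underlying points, and such
  formulas are preserved in both directions.\<close>

lemma embeds_interpret:
  assumes "embeds \<kappa> h A B" "qf_interp_scheme \<tau> \<kappa> I"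
  shows "embeds \<tau> (map h) (interpret_struct \<tau> I A) (interpret_struct \<tau> I B)"
proof -
  let ?D = "answers (exponent I) (dom_fm I)"
  have dom: "formula \<kappa> (exponent I) (dom_fm I)" "quantifier_free (dom_fm I)"
    using assms(2) by (auto simp: qf_interp_scheme_def interp_scheme_def)
  have sub: "set v \<subseteq> univ A" "length v = exponent I" if "v \<in> ?D A" for v
    using that by (auto simp: answers_def)
  have D: "map h v \<in> ?D B" if "v \<in> ?D A" for v
    using map_in_answers_iff[OF assms(1) dom sub(1)[OF that]] that by simp
  have "inj_on (map h) (?D A)"
  proof (rule inj_onI)
    fix v w assume vw: "v \<in> ?D A" "w \<in> ?D A" "map h v = map h w"
    have "inj_on h (set v \<union> set w)"
      using assms(1) sub(1)[OF vw(1)] sub(1)[OF vw(2)]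
      by (auto simp: embeds_def intro: inj_on_subset[of h "univ A"])
    then show "v = w" using inj_on_map_eq_map vw(3) by blast
  qed
  moreover have "vs \<in> rels (interpret_struct \<tau> I A) R \<longleftrightarrow>
      map (map h) vs \<in> rels (interpret_struct \<tau> I B) R"
    if R: "R \<in> symbols \<tau>" and vs: "length vs = arity \<tau> R" "set vs \<subseteq> ?D A" for R vs
  proof -
    have f: "formula \<kappa> (exponent I * arity \<tau> R) (rel_fm I R)" "quantifier_free (rel_fm I R)"
      using assms(2) R by (auto simp: qf_interp_scheme_def interp_scheme_def)
    have "map length vs = map (\<lambda>_. exponent I) vs"
      using vs(2) sub(2) by (auto intro!: map_cong)
    then have "length (concat vs) = exponent I * arity \<tau> R"
      unfolding length_concat using vs(1) by (simp only: sum_list_triv) simp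
    moreover have "set (concat vs) \<subseteq> univ A" using vs(2) sub(1) by fastforce
    ultimately have "holds_at B (rel_fm I R) (concat (map (map h) vs))
        \<longleftrightarrow> holds_at A (rel_fm I R) (concat vs)"
      using holds_at_map[OF assms(1) f, of "concat vs"] by (simp only: map_concat)
    then show ?thesis using vs D by (auto simp: interpret_struct_def)
  qed
  ultimately show ?thesis
    unfolding embeds_def using D by (auto simp: interpret_struct_def)
qed

lemma isomorphic_embeds:
  assumes "isomorphic \<sigma> A B"
  obtains f where "embeds \<sigma> f A B" "f ` univ A = univ B"
  using assms unfolding isomorphic_def embeds_def bij_betw_def by auto

lemma isomorphic_card_answers:
  assumes "isomorphic \<sigma> A B" "formula \<sigma> p \<phi>" "quantifier_free \<phi>"
  shows "card (answers p \<phi> A) = card (answers p \<phi> B)"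
proof -
  obtain f where f: "embeds \<sigma> f A B" "f ` univ A = univ B"
    using isomorphic_embeds[OF assms(1)] by blast
  have inj: "inj_on f (univ A)" using f by (simp add: embeds_def)
  have iff: "map f v \<in> answers p \<phi> B \<longleftrightarrow> v \<in> answers p \<phi> A" if "set v \<subseteq> univ A" for v
    using map_in_answers_iff[OF f(1) assms(2,3) that] .
  have sub: "set v \<subseteq> univ A" if "v \<in> answers p \<phi> A" for v
    using that by (simp add: answers_def)
  have "bij_betw (map f) (answers p \<phi> A) (answers p \<phi> B)"
    unfolding bij_betw_def
  proof
    show "inj_on (map f) (answers p \<phi> A)"
      by (rule inj_on_subset[OF inj_on_mapI[of f "answers p \<phi> A"]])
        (auto intro!: inj_on_subset[OF inj] dest: sub)
    show "map f ` answers p \<phi> A = answers p \<phi> B"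
    proof
      show "map f ` answers p \<phi> A \<subseteq> answers p \<phi> B" using iff sub by blast
      show "answers p \<phi> B \<subseteq> map f ` answers p \<phi> A"
      proof
        fix w assume w: "w \<in> answers p \<phi> B"
        then have "w \<in> lists (f ` univ A)" by (auto simp: answers_def f(2))
        then obtain v where "w = map f v" "set v \<subseteq> univ A"
          by (auto simp: lists_image)
        then show "w \<in> map f ` answers p \<phi> A" using iff w by blast
      qed
    qed
  qed
  then show ?thesis by (rule bij_betw_same_card)
qed

section \<open>Closure properties of polynomial functions\<close>

definition polynomial_fun :: "(nat \<Rightarrow> rat) \<Rightarrow> bool" where
  "polynomial_fun f \<longleftrightarrow> (\<exists>P. \<forall>n. f n = poly P (of_nat n))"

lemma polynomial_fun_const: "polynomial_fun (\<lambda>_. c)"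
  by (auto simp: polynomial_fun_def intro!: exI[of _ "[:c:]"])

lemma polynomial_fun_add:
  assumes "polynomial_fun f" "polynomial_fun g"
  shows "polynomial_fun (\<lambda>n. f n + g n)"
  using assms unfolding polynomial_fun_def by (metis poly_add)

lemma polynomial_fun_mult:
  assumes "polynomial_fun f" "polynomial_fun g"
  shows "polynomial_fun (\<lambda>n. f n * g n)"
  using assms unfolding polynomial_fun_def by (metis poly_mult)

lemma polynomial_fun_sum:
  assumes "\<And>i. i \<in> J \<Longrightarrow> polynomial_fun (f i)"
  shows "polynomial_fun (\<lambda>n. \<Sum>i\<in>J. f i n)"
  using assms
  by (induction J rule: infinite_finite_induct)
    (auto intro: polynomial_fun_const polynomial_fun_add)

lemma polynomial_fun_prod:
  assumes "\<And>i. i \<in> J \<Longrightarrow> polynomial_fun (f i)"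
  shows "polynomial_fun (\<lambda>n. \<Prod>i\<in>J. f i n)"
  using assms
  by (induction J rule: infinite_finite_induct)
    (auto intro: polynomial_fun_const polynomial_fun_mult)

text \<open>For fixed \<open>s\<close> the binomial coefficient is a product of \<open>s\<close>
  factors, each linear in \<open>f n\<close>, divided by the constant \<open>fact s\<close>.\<close>

lemma polynomial_fun_binomial:
  assumes "polynomial_fun (\<lambda>n. of_nat (f n))"
  shows "polynomial_fun (\<lambda>n. of_nat (f n choose s))"
proof -
  have *: "(\<lambda>n. rat_of_nat (f n choose s))
      = (\<lambda>n. (\<Prod>i = 0..<s. of_nat (f n) + - of_nat i) * (1 / fact s))"
    unfolding binomial_gbinomial gbinomial_prod_rev by (simp add: divide_simps)
  show ?thesis
    unfolding * by (intro polynomial_fun_mult polynomial_fun_prod polynomial_fun_add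
        polynomial_fun_const assms)
qed

section \<open>Interpretations of basic structures\<close>

lemma basic_rels [simp]:
  "v \<in> rels (basic_struct k l N) (E_part i, USym) \<longleftrightarrow> v = [(E_part i, 1)]"
  "v \<in> rels (basic_struct k l N) (T_part j, USym) \<longleftrightarrow> (\<exists>c\<in>{1..N j}. v = [(T_part j, c)])"
  "v \<in> rels (basic_struct k l N) (T_part j, SSym) \<longleftrightarrow>
     (\<exists>c\<in>{1..N j}. \<exists>d\<in>{1..N j}. c < d \<and> v = [(T_part j, c), (T_part j, d)])"
  by (auto simp: basic_struct_def strong_sum_def E_struct_def T_struct_def image_iff; force simp: Cons_eq_map_conv)+

lemma basic_univ [simp]:
  "univ (basic_struct k l N) = (\<lambda>i. (E_part i, 1)) ` {..<l} \<union> (\<Union>j<k. Pair (T_part j) ` {1..N j})"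
  by (auto simp: basic_struct_def strong_sum_def E_struct_def T_struct_def parts_def)

lemma basic_symbols [simp]:
  "symbols (basic_sig k l) = (\<lambda>i. (E_part i, USym)) ` {..<l} \<union>
     (\<lambda>j. (T_part j, USym)) ` {..<k} \<union> (\<lambda>j. (T_part j, SSym)) ` {..<k}"
  by (auto simp: basic_sig_def sig_sum_def parts_def E_sig_def T_sig_def)

lemma basic_sig_arity [simp]: "arity (basic_sig k l) (q, R) = basic_arity R"
  by (simp add: basic_sig_def sig_sum_def E_sig_def T_sig_def split: part.split)

text \<open>Enumerates each \<open>X j\<close> in increasing order. Tournament points are numbered
  from 1 and list positions from 0, hence \<open>c - 1\<close>.\<close>

fun basic_embedding :: "(nat \<Rightarrow> nat set) \<Rightarrow> part \<times> nat \<Rightarrow> part \<times> nat" where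
  "basic_embedding X (E_part i, c) = (E_part i, c)"
| "basic_embedding X (T_part j, c) = (T_part j, sorted_list_of_set (X j) ! (c - 1))"

lemma nth_sorted_list_of_set_less_iff:
  fixes X :: "nat set"
  assumes "finite X" "i < card X" "j < card X"
  shows "sorted_list_of_set X ! i < sorted_list_of_set X ! j \<longleftrightarrow> i < j"
proof -
  have "sorted_list_of_set X ! a < sorted_list_of_set X ! b" if "a < b" "b < card X" for a b
    using sorted_wrt_nth_less[OF sorted_list_of_set.strict_sorted_key_list_of_set] that by simp
  then show ?thesis using assms by (metis linorder_neqE_nat order_less_asym order_less_irrefl)
qed

text \<open>The increasing enumeration is an order isomorphism from \<open>{1..s j}\<close> onto
  \<open>X j\<close>, and the points of the one-element parts stay fixed.\<close>

lemma embeds_basic_embedding: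
  assumes "\<And>j. j < k \<Longrightarrow> X j \<subseteq> {1..N j} \<and> s j = card (X j)"
  shows "embeds (basic_sig k l) (basic_embedding X) (basic_struct k l s) (basic_struct k l N)"
    and "basic_embedding X ` univ (basic_struct k l s)
      = (\<lambda>i. (E_part i, 1)) ` {..<l} \<union> (\<Union>j<k. Pair (T_part j) ` X j)"
    and "\<And>j. j < k \<Longrightarrow> basic_embedding X ` Pair (T_part j) ` {1..s j} = Pair (T_part j) ` X j"
proof -
  have fin: "finite (X j)" if "j < k" for j
    using assms[OF that] finite_subset by blast
  have img: "(\<lambda>c. sorted_list_of_set (X j) ! (c - 1)) ` {1..s j} = X j" if "j < k" for j
  proof -
    have "{1..s j} = Suc ` {..<card (X j)}"
      using assms[OF that] by (simp add: image_Suc_lessThan)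
    then have "(\<lambda>c. sorted_list_of_set (X j) ! (c - 1)) ` {1..s j}
        = (!) (sorted_list_of_set (X j)) ` {..<length (sorted_list_of_set (X j))}"
      using fin[OF that] by (simp add: image_image)
    also have "\<dots> = set (sorted_list_of_set (X j))"
      by (auto simp: set_conv_nth simp del: set_sorted_list_of_set sorted_list_of_set.length_sorted_key_list_of_set)
    also have "\<dots> = X j" using fin[OF that] by simp
    finally show ?thesis .
  qed
  show imT: "basic_embedding X ` Pair (T_part j) ` {1..s j} = Pair (T_part j) ` X j" if "j < k" for j
    using arg_cong[OF img[OF that], of "(`) (Pair (T_part j))"] by (simp add: image_image)
  have mono: "sorted_list_of_set (X j) ! (c - 1) < sorted_list_of_set (X j) ! (d - 1) \<longleftrightarrow> c < d"
    if "j < k" "c \<in> {1..s j}" "d \<in> {1..s j}" for j c d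
  proof -
    have "c - 1 < card (X j)" "d - 1 < card (X j)" "c - 1 < d - 1 \<longleftrightarrow> c < d"
      using that assms[of j] by auto
    then show ?thesis
      using nth_sorted_list_of_set_less_iff[OF fin[OF that(1)], of "c - 1" "d - 1"] by simp
  qed
  have mem: "sorted_list_of_set (X j) ! (c - 1) \<in> {1..N j}" if "j < k" "c \<in> {1..s j}" for j c
    using img[OF that(1)] assms[OF that(1)] that(2) by blast
  show im: "basic_embedding X ` univ (basic_struct k l s)
      = (\<lambda>i. (E_part i, 1)) ` {..<l} \<union> (\<Union>j<k. Pair (T_part j) ` X j)"
    using imT by (simp add: image_Un image_UN) (simp add: image_image)
  have inj: "inj_on (basic_embedding X) (univ (basic_struct k l s))"
  proof (rule inj_onI)
    fix a b assume ab: "a \<in> univ (basic_struct k l s)" "b \<in> univ (basic_struct k l s)"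
      "basic_embedding X a = basic_embedding X b"
    obtain q c q' d where [simp]: "a = (q, c)" "b = (q', d)" by fastforce
    show "a = b"
    proof (cases q)
      case (E_part i)
      then show ?thesis using ab by (cases q') auto
    next
      case (T_part j)
      then have "q' = T_part j" using ab by (cases q') auto
      \<comment> \<open>Equal images exclude both \<open>c < d\<close> and \<open>d < c\<close> by
        \<open>mono\<close>.\<close>
      then have "c = d" using mono[of j c d] mono[of j d c] ab T_part
        by (auto simp del: One_nat_def)
      then show ?thesis using T_part \<open>q' = _\<close> by simp
    qed
  qed
  have rel: "v \<in> rels (basic_struct k l s) (q, R) \<longleftrightarrow>
      map (basic_embedding X) v \<in> rels (basic_struct k l N) (q, R)"
    if asm: "(q, R) \<in> symbols (basic_sig k l)" "length v = basic_arity R" "set v \<subseteq> univ (basic_struct k l s)" for v q R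
  proof (cases R)
    case USym
    then obtain a where "v = [a]" using asm(2) by (auto simp: length_Suc_conv)
    then show ?thesis using asm USym mem by (cases q; cases a; cases "fst a") force+
  next
    case SSym
    then obtain j where j: "q = T_part j" "j < k" using asm(1) by auto
    obtain a b where v: "v = [a, b]" using asm(2) SSym by (auto simp: length_Suc_conv numeral_2_eq_2)
    obtain q1 c q2 d where ab: "a = (q1, c)" "b = (q2, d)" by fastforce
    show ?thesis
    proof (cases "q1 = T_part j \<and> q2 = T_part j")
      case True
      then have "c \<in> {1..s j}" "d \<in> {1..s j}" using asm(3) v ab by auto
      then show ?thesis using True mono[of j c d] mem[of j c] mem[of j d] j SSym v ab by auto
    next
      case False
      then show ?thesis using j SSym v ab by (cases q1; cases q2) auto
    qed
  qed
  have sub: "basic_embedding X ` univ (basic_struct k l s) \<subseteq> univ (basic_struct k l N)"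
    unfolding im using assms by fastforce
  show "embeds (basic_sig k l) (basic_embedding X) (basic_struct k l s) (basic_struct k l N)"
    unfolding embeds_def
  proof (intro conjI ballI allI impI inj sub)
    fix r v
    assume "r \<in> symbols (basic_sig k l)"
      "length v = arity (basic_sig k l) r \<and> set v \<subseteq> univ (basic_struct k l s)"
    moreover obtain q R where "r = (q, R)" by fastforce
    ultimately show "v \<in> rels (basic_struct k l s) r
        \<longleftrightarrow> map (basic_embedding X) v \<in> rels (basic_struct k l N) r"
      using rel[of q R v] by (simp del: basic_symbols basic_univ basic_rels)
  qed
qed

section \<open>Counting answers by the tournament points that they use\<close>

definition supp :: "nat \<Rightarrow> (part \<times> nat) list list \<Rightarrow> nat \<Rightarrow> nat set" where
  "supp k vs = (\<lambda>j\<in>{..<k}. {c. (T_part j, c) \<in> set (concat vs)})"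

text \<open>If the entries of \<open>vs\<close> come from the sets \<open>X j\<close> and the
  one-element parts, half of the equality is already given. The remaining inclusion is easy to
  transport along an injection. Since supports are restricted to \<open>{..<k}\<close>,
  extensionality of \<open>X\<close> makes equality of functions meaningful.\<close>

lemma supp_eq_iff:
  assumes "set (concat vs) \<subseteq> (\<lambda>i. (E_part i, 1)) ` {..<l} \<union> (\<Union>j<k. Pair (T_part j) ` X j)"
    and "X \<in> extensional {..<k}"
  shows "supp k vs = X \<longleftrightarrow> (\<Union>j<k. Pair (T_part j) ` X j) \<subseteq> set (concat vs)"
proof
  assume "supp k vs = X"
  then show "(\<Union>j<k. Pair (T_part j) ` X j) \<subseteq> set (concat vs)"
    by (auto simp: supp_def)
next
  assume *: "(\<Union>j<k. Pair (T_part j) ` X j) \<subseteq> set (concat vs)"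
  have "{c. (T_part j, c) \<in> set (concat vs)} = X j" if "j < k" for j
    using * assms(1) that by (auto simp del: set_concat)
  then show "supp k vs = X"
    using assms(2) by (auto simp: supp_def fun_eq_iff restrict_def extensional_def)
qed

context
  fixes k l :: nat and \<tau> :: "'t signature" and I :: "(part \<times> basic_sym, 't) scheme"
    and p :: nat and \<phi> :: "'t fm"
  assumes scheme: "qf_interp_scheme \<tau> (basic_sig k l) I"
    and \<phi>: "formula \<tau> p \<phi>" "quantifier_free \<phi>"
begin

definition basic_answers :: "(nat \<Rightarrow> nat) \<Rightarrow> (part \<times> nat) list list set" where
  "basic_answers N = answers p \<phi> (interpret_struct \<tau> I (basic_struct k l N))"

text \<open>The total length bounds the size of every support independently of
  \<open>N\<close>.\<close>

lemma basic_answers_subset: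
  assumes "vs \<in> basic_answers N"
  shows "set (concat vs) \<subseteq> univ (basic_struct k l N)" "length (concat vs) = exponent I * p"
proof -
  have vs: "length vs = p" "\<And>v. v \<in> set vs \<Longrightarrow> length v = exponent I \<and> set v \<subseteq> univ (basic_struct k l N)"
    using assms by (auto simp: basic_answers_def answers_def interpret_struct_def simp del: basic_univ)
  then have "map length vs = map (\<lambda>_. exponent I) vs" by auto
  then show "length (concat vs) = exponent I * p"
    unfolding length_concat using vs(1) by (simp only: sum_list_triv) simp
  show "set (concat vs) \<subseteq> univ (basic_struct k l N)" using vs(2) by (auto simp del: basic_univ)
qed

lemma finite_basic_answers: "finite (basic_answers N)"
proof -
  have "finite (univ (interpret_struct \<tau> I (basic_struct k l N)))"
  proof -
    have "finite (answers (exponent I) (dom_fm I) (basic_struct k l N))"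
      by (rule finite_subset[OF _ finite_lists_length_eq[of "univ (basic_struct k l N)" "exponent I"]])
        (auto simp: answers_def)
    then show ?thesis by (simp add: interpret_struct_def)
  qed
  from finite_lists_length_eq[OF this, of p] show ?thesis
    by (rule rev_finite_subset) (auto simp: basic_answers_def answers_def)
qed

text \<open>The embedding given by \<open>X\<close> maps the answers that use every tournament point
  of the small structure bijectively to the answers with support \<open>X\<close>. Thus only the
  cardinalities \<open>s\<close> matter.\<close>

lemma card_basic_answers_supp:
  assumes X: "\<And>j. j < k \<Longrightarrow> X j \<subseteq> {1..N j} \<and> s j = card (X j)" and "X \<in> extensional {..<k}"
  shows "card {vs \<in> basic_answers N. supp k vs = X}
    = card {vs \<in> basic_answers s. supp k vs = (\<lambda>j\<in>{..<k}. {1..s j})}"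
proof -
  let ?B = "basic_struct k l" and ?I = "\<lambda>N. interpret_struct \<tau> I (basic_struct k l N)"
  define h where "h = basic_embedding X"
  have emb: "embeds (basic_sig k l) h (?B s) (?B N)"
    and im: "h ` univ (?B s) = (\<lambda>i. (E_part i, 1)) ` {..<l} \<union> (\<Union>j<k. Pair (T_part j) ` X j)"
    and imT: "\<And>j. j < k \<Longrightarrow> h ` Pair (T_part j) ` {1..s j} = Pair (T_part j) ` X j"
    using embeds_basic_embedding[OF X] by (simp_all only: h_def)
  have embI: "embeds \<tau> (map h) (?I s) (?I N)"
    using embeds_interpret[OF emb scheme] .
  have inj: "inj_on h (univ (?B s))" using emb by (simp only: embeds_def)
  have injI: "inj_on (map h) (univ (?I s))" using embI by (simp only: embeds_def)
  \<comment> \<open>Both supports are compared by inclusions, and \<open>h\<close> carries one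
    inclusion to the other because it is injective on the small structure.\<close>
  have supp_iff: "supp k (map (map h) vs) = X \<longleftrightarrow> supp k vs = (\<lambda>j\<in>{..<k}. {1..s j})"
    if vs: "vs \<in> basic_answers s" for vs
  proof -
    let ?V = "set (concat vs)" and ?T = "\<lambda>f. \<Union>j<k. Pair (T_part j) ` f j"
    have V: "?V \<subseteq> univ (?B s)" using basic_answers_subset[OF vs] by blast
    have hT: "h ` ?T (\<lambda>j. {1..s j}) = ?T X"
      using imT by (simp add: image_UN)
    have "?T (\<lambda>j\<in>{..<k}. {1..s j}) = ?T (\<lambda>j. {1..s j})" by auto
    then have 1: "supp k vs = (\<lambda>j\<in>{..<k}. {1..s j}) \<longleftrightarrow> ?T (\<lambda>j. {1..s j}) \<subseteq> ?V"
      using supp_eq_iff[where vs = vs and l = l and k = k and X = "\<lambda>j\<in>{..<k}. {1..s j}"] V by simp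
    have hV: "set (concat (map (map h) vs)) = h ` ?V" by auto
    have "h ` ?V \<subseteq> (\<lambda>i. (E_part i, 1)) ` {..<l} \<union> ?T X"
      using image_mono[OF V, of h] im by (simp only:)
    then have 2: "supp k (map (map h) vs) = X \<longleftrightarrow> ?T X \<subseteq> h ` ?V"
      using supp_eq_iff[where vs = "map (map h) vs" and l = l, OF _ assms(2)] unfolding hV by simp
    have "?T (\<lambda>j. {1..s j}) \<subseteq> univ (?B s)" by auto
    then have 3: "?T X \<subseteq> h ` ?V \<longleftrightarrow> ?T (\<lambda>j. {1..s j}) \<subseteq> ?V"
      unfolding hT[symmetric] using inj_on_image_mem_iff[OF inj _ V] by blast
    show ?thesis using 1 2 3 by blast
  qed
  have "bij_betw (map (map h)) {vs \<in> basic_answers s. supp k vs = (\<lambda>j\<in>{..<k}. {1..s j})}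
      {vs \<in> basic_answers N. supp k vs = X}" (is "bij_betw _ ?L ?R")
    unfolding bij_betw_def
  proof
    have sub: "set vs \<subseteq> univ (?I s)" if "vs \<in> basic_answers s" for vs
      using that by (simp add: basic_answers_def answers_def)
    show "inj_on (map (map h)) ?L"
      by (rule inj_on_subset[OF inj_on_mapI[of "map h" ?L]])
        (auto intro!: inj_on_subset[OF injI] dest: sub)
    have iff: "map (map h) vs \<in> basic_answers N \<longleftrightarrow> vs \<in> basic_answers s" if "set vs \<subseteq> univ (?I s)" for vs
      using map_in_answers_iff[OF embI \<phi> that] by (simp add: basic_answers_def)
    show "map (map h) ` ?L = ?R"
    proof
      show "map (map h) ` ?L \<subseteq> ?R" using iff sub supp_iff by auto
      show "?R \<subseteq> map (map h) ` ?L"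
      proof
        fix ws assume ws: "ws \<in> ?R"
        \<comment> \<open>An answer with support \<open>X\<close> only uses points in the image of
          \<open>h\<close>, so it can be pulled back.\<close>
        have "set (concat ws) \<subseteq> h ` univ (?B s)"
        proof
          fix a assume a: "a \<in> set (concat ws)"
          then have "a \<in> univ (?B N)" using ws basic_answers_subset(1) by blast
          moreover have "c \<in> X j" if "a = (T_part j, c)" "j < k" for j c
            using ws a that by (auto simp: supp_def)
          ultimately show "a \<in> h ` univ (?B s)" unfolding im by fastforce
        qed
        then have "set w \<subseteq> h ` univ (?B s)" if "w \<in> set ws" for w
          using that by (auto simp del: basic_univ)
        then have "w \<in> map h ` lists (univ (?B s))" if "w \<in> set ws" for w
          using that by (auto simp: lists_image[symmetric] simp del: basic_univ)
        then have "ws \<in> lists (map h ` lists (univ (?B s)))" by blast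
        then obtain vs where vs: "ws = map (map h) vs" "vs \<in> lists (lists (univ (?B s)))"
          unfolding lists_image by blast
        have "set vs \<subseteq> univ (?I s)"
        proof
          fix v assume v: "v \<in> set vs"
          have "map h v \<in> univ (?I N)"
            using ws vs v by (auto simp: basic_answers_def answers_def)
          then show "v \<in> univ (?I s)"
            using map_in_answers_iff[OF emb, of "exponent I" "dom_fm I" v] scheme vs(2) v
            by (auto simp: interpret_struct_def qf_interp_scheme_def interp_scheme_def simp del: basic_univ)
        qed
        then show "ws \<in> map (map h) ` ?L" using ws vs(1) iff supp_iff by auto
      qed
    qed
  qed
  then show ?thesis by (rule bij_betw_same_card[symmetric])
qed

lemma polynomial_fun_card_basic_answers:
  assumes "\<And>j. j < k \<Longrightarrow> polynomial_fun (\<lambda>n. of_nat (N n j))"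
  shows "polynomial_fun (\<lambda>n. of_nat (card (basic_answers (N n))))"
proof -
  \<comment> \<open>An answer has \<open>M\<close> entries in total, so no support has a component
    with more than \<open>M\<close> elements. Hence only the finitely many cardinality profiles in
    \<open>S\<close> occur, and \<open>S\<close> is the same for all \<open>N\<close>.\<close>
  define M where "M = exponent I * p"
  define S where "S = ({..<k} \<rightarrow>\<^sub>E {..M} :: (nat \<Rightarrow> nat) set)"
  define g where "g s = card {vs \<in> basic_answers s. supp k vs = (\<lambda>j\<in>{..<k}. {1..s j})}" for s
  define prof :: "(nat \<Rightarrow> nat set) \<Rightarrow> nat \<Rightarrow> nat" where "prof X = (\<lambda>j\<in>{..<k}. card (X j))" for X
  have S: "finite S" by (auto simp: S_def intro: finite_PiE)
  have "card (basic_answers N) = (\<Sum>s\<in>S. g s * (\<Prod>j<k. N j choose s j))" for N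
  proof -
    define XX where "XX = {X \<in> (\<Pi>\<^sub>E j\<in>{..<k}. Pow {1..N j}). prof X \<in> S}"
    have fin: "finite XX" by (auto simp: XX_def intro!: finite_PiE)
    have supp: "supp k ` basic_answers N \<subseteq> XX"
    proof
      fix X assume "X \<in> supp k ` basic_answers N"
      then obtain vs where vs: "vs \<in> basic_answers N" "X = supp k vs" by blast
      have "card (X j) \<le> M" if "j < k" for j
      proof -
        have "Pair (T_part j) ` X j \<subseteq> set (concat vs)" using vs that by (auto simp: supp_def)
        then have "card (Pair (T_part j) ` X j) \<le> card (set (concat vs))"
          by (intro card_mono) simp_all
        also have "\<dots> \<le> M" using basic_answers_subset(2)[OF vs(1)] card_length[of "concat vs"] by (simp only: M_def)
        finally show ?thesis by (subst (asm) card_image) (auto simp: inj_on_def)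
      qed
      moreover have "X j \<subseteq> {1..N j}" if "j < k" for j
        using basic_answers_subset(1)[OF vs(1)] vs(2) that by (auto simp: supp_def)
      ultimately show "X \<in> XX" using vs(2) by (auto simp: XX_def S_def prof_def supp_def)
    qed
    have "card (basic_answers N) = (\<Sum>X\<in>XX. card {vs \<in> basic_answers N. supp k vs = X})"
      using sum.group[OF finite_basic_answers fin supp, of "\<lambda>_. 1::nat"] by simp
    also have "\<dots> = (\<Sum>X\<in>XX. g (prof X))"
    proof (rule sum.cong[OF refl])
      fix X assume "X \<in> XX"
      then show "card {vs \<in> basic_answers N. supp k vs = X} = g (prof X)"
        unfolding g_def by (intro card_basic_answers_supp) (auto simp: XX_def prof_def PiE_iff)
    qed
    also have "\<dots> = (\<Sum>s\<in>S. \<Sum>X\<in>{X \<in> XX. prof X = s}. g (prof X))"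
      by (rule sum.group[symmetric, OF fin S]) (auto simp: XX_def)
    also have "\<dots> = (\<Sum>s\<in>S. g s * (\<Prod>j<k. N j choose s j))"
    proof (rule sum.cong[OF refl])
      fix s assume s: "s \<in> S"
      \<comment> \<open>Once the profile is fixed, the subsets of the different tournaments are
        chosen independently; this gives the product of binomial coefficients.\<close>
      have "{X \<in> XX. prof X = s} = (\<Pi>\<^sub>E j\<in>{..<k}. {Y. Y \<subseteq> {1..N j} \<and> card Y = s j})"
        (is "?L = ?R")
      proof
        show "?L \<subseteq> ?R" by (auto simp: XX_def prof_def PiE_iff extensional_def)
        have "prof X = s" if "X \<in> ?R" for X
          using that s by (auto simp: prof_def S_def PiE_iff extensional_def fun_eq_iff)
        then show "?R \<subseteq> ?L" using s by (auto simp: XX_def PiE_iff)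
      qed
      then have "card {X \<in> XX. prof X = s} = (\<Prod>j<k. N j choose s j)"
        by (simp add: card_PiE n_subsets)
      moreover have "(\<Sum>X\<in>{X \<in> XX. prof X = s}. g (prof X)) = (\<Sum>X\<in>{X \<in> XX. prof X = s}. g s)"
        by (rule sum.cong) auto
      ultimately show "(\<Sum>X\<in>{X \<in> XX. prof X = s}. g (prof X)) = g s * (\<Prod>j<k. N j choose s j)"
        by simp
    qed
    finally show ?thesis .
  qed
  then have *: "(\<lambda>n. rat_of_nat (card (basic_answers (N n))))
      = (\<lambda>n. \<Sum>s\<in>S. of_nat (g s) * (\<Prod>j<k. of_nat (N n j choose s j)))"
    by simp
  show ?thesis
    unfolding * using assms
    by (intro polynomial_fun_sum polynomial_fun_mult polynomial_fun_const polynomial_fun_prod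
        polynomial_fun_binomial) auto
qed

end

lemma qf_interpretation_imp_strongly_polynomial:
  assumes "\<And>n. is_graph (A n)" "qf_interpretation_of_basic_sequence A"
  shows "strongly_polynomial graph_sig A"
proof -
  obtain k l B I where B: "basic_sequence k l B" and I: "qf_interp_scheme graph_sig (basic_sig k l) I"
    and iso: "\<And>n. isomorphic graph_sig (A n) (interpret_struct graph_sig I (B n))"
    using assms(2) unfolding qf_interpretation_of_basic_sequence_def by blast
  obtain N and Q :: "nat \<Rightarrow> rat poly" where NQ: "\<forall>n. B n = basic_struct k l (N n)"
    "\<forall>j<k. degree (Q j) > 0 \<and> (\<forall>n. of_nat (N n j) = poly (Q j) (of_nat n))"
    using B unfolding basic_sequence_def by (elim exE conjE)
  then have N: "\<And>n. B n = basic_struct k l (N n)" by simp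
  have poly_N: "polynomial_fun (\<lambda>n. of_nat (N n j))" if "j < k" for j
    unfolding polynomial_fun_def using NQ(2) that by blast
  have "\<exists>P :: rat poly. \<forall>n. of_nat (card (answers p \<phi> (A n))) = poly P (of_nat n)"
    if \<phi>: "formula graph_sig p \<phi>" "quantifier_free \<phi>" for p \<phi>
  proof -
    have "polynomial_fun (\<lambda>n. of_nat (card (answers p \<phi> (interpret_struct graph_sig I (basic_struct k l (N n))))))"
      using polynomial_fun_card_basic_answers[OF I \<phi>, of N] poly_N
      unfolding basic_answers_def[OF I \<phi>] by blast
    then show ?thesis
      unfolding polynomial_fun_def isomorphic_card_answers[OF iso \<phi>] N .
  qed
  then show ?thesis using assms(1) by (auto simp: strongly_polynomial_def is_graph_def)
qed

section \<open>Disjoint unions as interpretations\<close>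

definition qf_definable ::
  "'s signature \<Rightarrow> nat \<Rightarrow> (('s, 'a) rstruct \<Rightarrow> 'a list \<Rightarrow> bool) \<Rightarrow> bool" where
  "qf_definable \<sigma> r \<Psi> \<longleftrightarrow> (\<exists>\<phi>. wf_fm \<sigma> \<phi> \<and> free_vars \<phi> \<subseteq> {..<r} \<and> quantifier_free \<phi> \<and>
     (\<forall>A v. length v = r \<longrightarrow> (holds_at A \<phi> v \<longleftrightarrow> \<Psi> A v)))"

lemma basic_univ_iff:
  "(E_part i, c) \<in> univ (basic_struct k l N) \<longleftrightarrow> i < l \<and> c = 1"
  "(T_part j, c) \<in> univ (basic_struct k l N) \<longleftrightarrow> j < k \<and> c \<in> {1..N j}"
  by (auto simp: image_iff)

lemma qf_definable_not:
  assumes "qf_definable \<sigma> r \<Psi>"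
  shows "qf_definable \<sigma> r (\<lambda>A v. \<not> \<Psi> A v)"
proof -
  obtain \<phi> where "wf_fm \<sigma> \<phi>" "free_vars \<phi> \<subseteq> {..<r}" "quantifier_free \<phi>"
    "\<And>A v. length v = r \<Longrightarrow> holds_at A \<phi> v \<longleftrightarrow> \<Psi> A v"
    using assms unfolding qf_definable_def by blast
  then show ?thesis
    unfolding qf_definable_def by (intro exI[of _ "Neg \<phi>"]) (auto simp: holds_at_def)
qed

lemma qf_definable_conj:
  assumes "qf_definable \<sigma> r \<Psi>" "qf_definable \<sigma> r \<Phi>"
  shows "qf_definable \<sigma> r (\<lambda>A v. \<Psi> A v \<and> \<Phi> A v)"
proof -
  obtain \<phi> where "wf_fm \<sigma> \<phi>" "free_vars \<phi> \<subseteq> {..<r}" "quantifier_free \<phi>"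
    "\<And>A v. length v = r \<Longrightarrow> holds_at A \<phi> v \<longleftrightarrow> \<Psi> A v"
    using assms(1) unfolding qf_definable_def by blast
  moreover obtain \<psi> where "wf_fm \<sigma> \<psi>" "free_vars \<psi> \<subseteq> {..<r}" "quantifier_free \<psi>"
    "\<And>A v. length v = r \<Longrightarrow> holds_at A \<psi> v \<longleftrightarrow> \<Phi> A v"
    using assms(2) unfolding qf_definable_def by blast
  ultimately show ?thesis
    unfolding qf_definable_def by (intro exI[of _ "Conj \<phi> \<psi>"]) (auto simp: holds_at_def)
qed

lemma qf_definable_eq:
  assumes "i < r" "j < r"
  shows "qf_definable \<sigma> r (\<lambda>A v. v ! i = v ! j)"
  unfolding qf_definable_def using assms by (intro exI[of _ "Eq i j"]) (auto simp: holds_at_def)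

lemma qf_definable_rel:
  assumes "R \<in> symbols \<sigma>" "length xs = arity \<sigma> R" "set xs \<subseteq> {..<r}"
  shows "qf_definable \<sigma> r (\<lambda>A v. map ((!) v) xs \<in> rels A R)"
  unfolding qf_definable_def using assms by (intro exI[of _ "Atom R xs"]) (auto simp: holds_at_def)

lemma qf_definable_const: "qf_definable \<sigma> r (\<lambda>_ _. b)"
  unfolding qf_definable_def
  by (intro exI[of _ "if b then Neg Bot else Bot"]) (auto simp: holds_at_def)

lemma qf_definable_disj:
  assumes "qf_definable \<sigma> r \<Psi>" "qf_definable \<sigma> r \<Phi>"
  shows "qf_definable \<sigma> r (\<lambda>A v. \<Psi> A v \<or> \<Phi> A v)"
  using qf_definable_not[OF qf_definable_conj[OF assms[THEN qf_definable_not]]] by simp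

lemma qf_definable_iff:
  assumes "qf_definable \<sigma> r \<Psi>"
  shows "qf_definable \<sigma> r (\<lambda>A v. \<Psi> A v \<longleftrightarrow> b)"
  using assms qf_definable_not[OF assms] by (cases b) simp_all

lemma qf_definable_ball:
  assumes "finite J" "\<And>j. j \<in> J \<Longrightarrow> qf_definable \<sigma> r (\<Psi> j)"
  shows "qf_definable \<sigma> r (\<lambda>A v. \<forall>j\<in>J. \<Psi> j A v)"
  using assms by induction (auto intro: qf_definable_const qf_definable_conj)

lemma qf_definable_bex:
  assumes "finite J" "\<And>j. j \<in> J \<Longrightarrow> qf_definable \<sigma> r (\<Psi> j)"
  shows "qf_definable \<sigma> r (\<lambda>A v. \<exists>j\<in>J. \<Psi> j A v)"
  using assms by induction (auto intro: qf_definable_const qf_definable_disj)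

text \<open>A conjunction of equations \<open>Eq i i\<close>. Conjoined with another formula it
  supplies the missing free variables without changing the meaning; \<open>formula\<close> demands
  exactly \<open>{..<r}\<close>, while \<open>qf_definable\<close> only bounds the free
  variables.\<close>

lemma ex_valid_formula:
  "\<exists>\<psi>. wf_fm \<sigma> \<psi> \<and> free_vars \<psi> = {..<r} \<and> quantifier_free \<psi> \<and>
     (\<forall>(A :: ('s, 'a) rstruct) v. holds_at A \<psi> v)"
proof (induction r)
  case 0
  show ?case by (intro exI[of _ "Neg Bot"]) (simp add: holds_at_def)
next
  case (Suc r)
  then obtain \<psi> where "wf_fm \<sigma> \<psi>" "free_vars \<psi> = {..<r}" "quantifier_free \<psi>"
    "\<forall>(A :: ('s, 'a) rstruct) v. holds_at A \<psi> v"
    by blast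
  then show ?case
    by (intro exI[of _ "Conj \<psi> (Eq r r)"]) (auto simp: holds_at_def)
qed

lemma qf_definable_formula:
  fixes \<Psi> :: "('s, 'a) rstruct \<Rightarrow> 'a list \<Rightarrow> bool"
  assumes "qf_definable \<sigma> r \<Psi>"
  obtains \<phi> where "formula \<sigma> r \<phi>" "quantifier_free \<phi>"
    "\<And>A v. length v = r \<Longrightarrow> holds_at A \<phi> v \<longleftrightarrow> \<Psi> A v"
proof -
  obtain \<phi> where \<phi>: "wf_fm \<sigma> \<phi>" "free_vars \<phi> \<subseteq> {..<r}" "quantifier_free \<phi>"
    "\<And>A v. length v = r \<Longrightarrow> holds_at A \<phi> v \<longleftrightarrow> \<Psi> A v"
    using assms unfolding qf_definable_def by blast
  obtain \<psi> where "wf_fm \<sigma> \<psi>" "free_vars \<psi> = {..<r}" "quantifier_free \<psi>"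
    "\<And>A :: ('s, 'a) rstruct. \<And>v. holds_at A \<psi> v"
    using ex_valid_formula[where ?'a = 'a and \<sigma> = \<sigma> and r = r] by metis
  then show thesis
    using \<phi> by (intro that[of "Conj \<phi> \<psi>"]) (auto simp: holds_at_def formula_def)
qed

section \<open>Isomorphisms and the realization of disjoint unions\<close>

lemma isomorphic_sym:
  assumes "isomorphic \<sigma> A B"
  shows "isomorphic \<sigma> B A"
proof -
  obtain f where f: "bij_betw f (univ A) (univ B)"
    and rel: "\<And>R v. R \<in> symbols \<sigma> \<Longrightarrow> length v = arity \<sigma> R \<Longrightarrow> set v \<subseteq> univ A \<Longrightarrow>
        v \<in> rels A R \<longleftrightarrow> map f v \<in> rels B R"
    using assms unfolding isomorphic_def by blast
  define g where "g = inv_into (univ A) f"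
  have g: "bij_betw g (univ B) (univ A)" unfolding g_def by (rule bij_betw_inv_into[OF f])
  have fg: "f (g y) = y" if "y \<in> univ B" for y
    unfolding g_def by (rule bij_betw_inv_into_right[OF f that])
  have "v \<in> rels B R \<longleftrightarrow> map g v \<in> rels A R"
    if "R \<in> symbols \<sigma>" "length v = arity \<sigma> R" "set v \<subseteq> univ B" for R v
  proof -
    have "map f (map g v) = v" using that(3) fg by (auto intro!: map_idI)
    moreover have "set (map g v) \<subseteq> univ A" using g that(3) by (auto simp: bij_betw_def)
    ultimately show ?thesis using rel[of R "map g v"] that by simp
  qed
  then show ?thesis using g unfolding isomorphic_def by blast
qed

lemma isomorphic_trans:
  assumes "isomorphic \<sigma> A B" "isomorphic \<sigma> B C"
  shows "isomorphic \<sigma> A C"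
proof -
  obtain f where f: "bij_betw f (univ A) (univ B)"
    and relf: "\<And>R v. R \<in> symbols \<sigma> \<Longrightarrow> length v = arity \<sigma> R \<Longrightarrow> set v \<subseteq> univ A \<Longrightarrow>
        v \<in> rels A R \<longleftrightarrow> map f v \<in> rels B R"
    using assms(1) unfolding isomorphic_def by blast
  obtain g where g: "bij_betw g (univ B) (univ C)"
    and relg: "\<And>R v. R \<in> symbols \<sigma> \<Longrightarrow> length v = arity \<sigma> R \<Longrightarrow> set v \<subseteq> univ B \<Longrightarrow>
        v \<in> rels B R \<longleftrightarrow> map g v \<in> rels C R"
    using assms(2) unfolding isomorphic_def by blast
  have "v \<in> rels A R \<longleftrightarrow> map (g \<circ> f) v \<in> rels C R"
    if "R \<in> symbols \<sigma>" "length v = arity \<sigma> R" "set v \<subseteq> univ A" for R v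
  proof -
    have "set (map f v) \<subseteq> univ B" using f that(3) by (auto simp: bij_betw_def)
    then show ?thesis using relf[of R v] relg[of R "map f v"] that by simp
  qed
  then show ?thesis
    using bij_betw_trans[OF f g] unfolding isomorphic_def by blast
qed

text \<open>Two vertices of \<open>I(B)\<close> can only be adjacent if they have the same first coordinate \<open>a\<close>;
  the part containing \<open>a\<close> determines the graph and the second coordinate the vertex of that graph.\<close>

lemma scheme_of_part_graphs:
  fixes G :: "part \<Rightarrow> nat graph"
  assumes "\<forall>q\<in>parts k l. is_graph (G q) \<and> univ (G q) \<subseteq> {..<l}"
  shows "\<exists>I :: (part \<times> basic_sym, graph_sym) scheme. qf_interp_scheme graph_sig (basic_sig k l) I \<and>
    (\<forall>N. univ (interpret_struct graph_sig I (basic_struct k l N))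
      = {[(q, c), (E_part x, 1)] | q c x. (q, c) \<in> univ (basic_struct k l N) \<and> x \<in> univ (G q)}) \<and>
    (\<forall>N q c x q' c' y. (q, c) \<in> univ (basic_struct k l N) \<and> x \<in> univ (G q) \<and>
      (q', c') \<in> univ (basic_struct k l N) \<and> y \<in> univ (G q') \<longrightarrow>
      (adjacent (interpret_struct graph_sig I (basic_struct k l N))
        [(q, c), (E_part x, 1)] [(q', c'), (E_part y, 1)]
      \<longleftrightarrow> (q, c) = (q', c') \<and> adjacent (G q) x y))"
proof -
  let ?\<sigma> = "basic_sig k l"
  have G: "is_graph (G q) \<and> univ (G q) \<subseteq> {..<l}" if "q \<in> parts k l" for q
    using assms that by blast
  have finp: "finite (parts k l)" by (simp add: parts_def)
  have finG: "finite (univ (G q))" if "q \<in> parts k l" for q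
    using G[OF that] by (simp add: is_graph_def is_struct_def)
  have U: "qf_definable ?\<sigma> r (\<lambda>B v. [v ! i] \<in> rels B (q, USym))"
    if "q \<in> parts k l" "i < r" for q i r
    using qf_definable_rel[of "(q, USym)" ?\<sigma> "[i]" r] that by (auto simp: parts_def)
  have UE: "qf_definable ?\<sigma> r (\<lambda>B v. [v ! i] \<in> rels B (E_part x, USym))"
    if "q \<in> parts k l" "x \<in> univ (G q)" "i < r" for q x i r
    by (rule U) (use G[OF that(1)] that in \<open>auto simp: parts_def\<close>)
  \<comment> \<open>The first coordinate may be any point, and its part \<open>q\<close> is read off
    from the unary relations. The second coordinate is the point of \<open>E_part x\<close>; such a
    part exists since the vertices of \<open>G q\<close> are below \<open>l\<close>.\<close>
  have "qf_definable ?\<sigma> 2 (\<lambda>B v. \<exists>q\<in>parts k l. \<exists>x\<in>univ (G q).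
      [v ! 0] \<in> rels B (q, USym) \<and> [v ! 1] \<in> rels B (E_part x, USym))"
    by (intro qf_definable_bex qf_definable_conj finp finG U UE) auto
  then obtain \<rho>0 where \<rho>0: "formula ?\<sigma> 2 \<rho>0" "quantifier_free \<rho>0"
    "\<And>B :: (part \<times> basic_sym, part \<times> nat) rstruct. \<And>v. length v = 2 \<Longrightarrow> holds_at B \<rho>0 v \<longleftrightarrow>
      (\<exists>q\<in>parts k l. \<exists>x\<in>univ (G q). [v ! 0] \<in> rels B (q, USym) \<and> [v ! 1] \<in> rels B (E_part x, USym))"
    by (rule qf_definable_formula) blast
  \<comment> \<open>The formula sees the concatenation of two vertices: positions 0 and 1 hold the
    first, positions 2 and 3 the second.\<close>
  have "qf_definable ?\<sigma> 4 (\<lambda>B v. v ! 0 = v ! 2 \<and>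
      (\<exists>q\<in>parts k l. \<exists>x\<in>univ (G q). \<exists>y\<in>univ (G q). adjacent (G q) x y \<and>
      [v ! 0] \<in> rels B (q, USym) \<and> [v ! 1] \<in> rels B (E_part x, USym) \<and> [v ! 3] \<in> rels B (E_part y, USym)))"
    by (intro qf_definable_bex qf_definable_conj qf_definable_const qf_definable_eq finp finG U UE) auto
  then obtain \<rho>1 where \<rho>1: "formula ?\<sigma> 4 \<rho>1" "quantifier_free \<rho>1"
    "\<And>B :: (part \<times> basic_sym, part \<times> nat) rstruct. \<And>v. length v = 4 \<Longrightarrow> holds_at B \<rho>1 v \<longleftrightarrow> v ! 0 = v ! 2 \<and>
      (\<exists>q\<in>parts k l. \<exists>x\<in>univ (G q). \<exists>y\<in>univ (G q). adjacent (G q) x y \<and>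
      [v ! 0] \<in> rels B (q, USym) \<and> [v ! 1] \<in> rels B (E_part x, USym) \<and> [v ! 3] \<in> rels B (E_part y, USym))"
    by (rule qf_definable_formula) blast
  define I :: "(part \<times> basic_sym, graph_sym) scheme"
    where "I = \<lparr>exponent = 2, dom_fm = \<rho>0, rel_fm = (\<lambda>_. \<rho>1)\<rparr>"
  \<comment> \<open>Each point satisfies exactly one unary relation, namely that of its own
    part.\<close>
  have mem: "[(q, c)] \<in> rels (basic_struct k l N) (q', USym) \<longleftrightarrow> q = q' \<and> (q, c) \<in> univ (basic_struct k l N)"
    if "q' \<in> parts k l" for q c q' N
    using that by (cases q') (auto simp: parts_def basic_univ_iff simp del: basic_univ)
  have in_parts: "q \<in> parts k l" if "(q, c) \<in> univ (basic_struct k l N)" for q c N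
    using that by (auto simp: parts_def)
  have E_univ: "(E_part x, 1) \<in> univ (basic_struct k l N)" if "q \<in> parts k l" "x \<in> univ (G q)" for q x N
    using G[OF that(1)] that(2) by auto
  have scheme: "qf_interp_scheme graph_sig ?\<sigma> I"
    using \<rho>0 \<rho>1 by (simp add: qf_interp_scheme_def interp_scheme_def I_def graph_sig_def)
  have dom: "univ (interpret_struct graph_sig I (basic_struct k l N))
      = {[(q, c), (E_part x, 1)] | q c x. (q, c) \<in> univ (basic_struct k l N) \<and> x \<in> univ (G q)}"
    (is "?L = ?R") for N
  proof (intro set_eqI iffI)
    fix v assume v: "v \<in> ?L"
    then obtain a b where ab: "v = [a, b]" "a \<in> univ (basic_struct k l N)"
      by (auto simp: interpret_struct_def answers_def I_def length_Suc_conv numeral_2_eq_2 simp del: basic_univ)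
    obtain q c where a: "a = (q, c)" by fastforce
    have "holds_at (basic_struct k l N) \<rho>0 v"
      using v by (simp add: interpret_struct_def answers_def I_def)
    then obtain q' x where "q' \<in> parts k l" "x \<in> univ (G q')" "[a] \<in> rels (basic_struct k l N) (q', USym)"
      "b = (E_part x, 1)"
      unfolding ab by (subst (asm) \<rho>0(3)) (auto simp del: basic_rels(2,3))
    then show "v \<in> ?R" using mem ab a by auto
  next
    fix v assume "v \<in> ?R"
    then obtain q c x where v: "v = [(q, c), (E_part x, 1)]" "(q, c) \<in> univ (basic_struct k l N)" "x \<in> univ (G q)"
      by blast
    note q = in_parts[OF v(2)]
    have "holds_at (basic_struct k l N) \<rho>0 v"
      using v q mem[OF q, of q c N] by (subst \<rho>0(3)) (auto simp del: basic_univ)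
    then show "v \<in> ?L"
      using v E_univ[OF q v(3), of N] by (simp add: interpret_struct_def answers_def I_def del: basic_univ)
  qed
  have adj: "adjacent (interpret_struct graph_sig I (basic_struct k l N))
        [(q, c), (E_part x, 1)] [(q', c'), (E_part y, 1)]
      \<longleftrightarrow> (q, c) = (q', c') \<and> adjacent (G q) x y"
    if as: "(q, c) \<in> univ (basic_struct k l N)" "x \<in> univ (G q)"
      "(q', c') \<in> univ (basic_struct k l N)" "y \<in> univ (G q')" for N q c x q' c' y
  proof -
    let ?W = "interpret_struct graph_sig I (basic_struct k l N)"
    note q = in_parts[OF as(1)]
    have "[(q, c), (E_part x, 1)] \<in> univ ?W" "[(q', c'), (E_part y, 1)] \<in> univ ?W"
      unfolding dom using as by blast+
    then have "adjacent ?W [(q, c), (E_part x, 1)] [(q', c'), (E_part y, 1)]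
      \<longleftrightarrow> holds_at (basic_struct k l N) \<rho>1 [(q, c), (E_part x, 1), (q', c'), (E_part y, 1)]"
      by (simp add: adjacent_def interpret_struct_def I_def graph_sig_def)
    also have "\<dots> \<longleftrightarrow> (q, c) = (q', c') \<and> (\<exists>q''\<in>parts k l. x \<in> univ (G q'') \<and> y \<in> univ (G q'') \<and>
        adjacent (G q'') x y \<and> [(q, c)] \<in> rels (basic_struct k l N) (q'', USym))"
      by (subst \<rho>1(3)) (auto simp del: basic_univ basic_rels(2,3))
    also have "\<dots> \<longleftrightarrow> (q, c) = (q', c') \<and> adjacent (G q) x y"
      using as q mem by (auto simp del: basic_univ basic_rels)
    finally show ?thesis .
  qed
  show ?thesis using scheme dom adj by (intro exI[of _ I] conjI allI impI) (simp_all del: basic_univ)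
qed

definition empty_graph :: "nat graph" where
  "empty_graph = \<lparr>univ = {}, rels = (\<lambda>_. {})\<rparr>"

lemma is_graph_empty_graph: "is_graph empty_graph"
  by (simp add: is_graph_def is_struct_def empty_graph_def adjacent_def graph_sig_def)

lemma isomorphic_graph_sig_I:
  assumes "bij_betw f (univ A) (univ B)"
    and "\<And>x y. x \<in> univ A \<Longrightarrow> y \<in> univ A \<Longrightarrow> adjacent A x y \<longleftrightarrow> adjacent B (f x) (f y)"
  shows "isomorphic graph_sig A B"
proof -
  have "v \<in> rels A Adj \<longleftrightarrow> map f v \<in> rels B Adj" if v: "length v = 2" "set v \<subseteq> univ A" for v
  proof -
    obtain x y where "v = [x, y]" using v(1) by (auto simp: length_Suc_conv numeral_2_eq_2)
    then show ?thesis using assms(2)[of x y] v(2) by (simp add: adjacent_def)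
  qed
  then show ?thesis using assms(1) unfolding isomorphic_def graph_sig_def by auto
qed

lemma adjacent_disjoint_union:
  "adjacent (disjoint_union J A) (i, x) (j, y) \<longleftrightarrow> i = j \<and> i \<in> J \<and> adjacent (A i) x y"
  by (force simp: adjacent_def disjoint_union_def Cons_eq_map_conv image_iff)

lemma polynomial_disjoint_union_imp_qf_interpretation:
  assumes "polynomial_disjoint_union A"
  shows "qf_interpretation_of_basic_sequence A"
proof -
  obtain k and F :: "nat \<Rightarrow> nat graph" and P :: "nat \<Rightarrow> rat poly" and m :: "nat \<Rightarrow> nat \<Rightarrow> nat" where
    F0: "\<forall>i<k. is_graph (F i)"
    and m0: "\<forall>i<k. \<forall>n. of_nat (m i n) = poly (P i) (of_nat n)"
    and iso: "\<forall>n. isomorphic graph_sig (A n) (disjoint_union {..<k} (\<lambda>i. copies (m i n) (F i)))"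
    using assms unfolding polynomial_disjoint_union_def by (elim exE conjE)
  define cst where "cst i \<longleftrightarrow> degree (P i) = 0" for i
  have F: "is_graph (F i)" if "i < k" for i using F0 that by blast
  have m: "of_nat (m i n) = poly (P i) (of_nat n)" if "i < k" for i n using m0 that by blast
  have m_cst: "m i n = m i 0" if i: "i < k" "cst i" for i n
  proof -
    obtain a where "P i = [:a:]" using i(2) unfolding cst_def by (rule degree_eq_zeroE)
    then have "(of_nat (m i n) :: rat) = of_nat (m i 0)" using m[OF i(1)] by simp
    then show ?thesis by simp
  qed
  \<comment> \<open>The number \<open>l\<close> of one-element parts must exceed both the vertices
    of the graphs \<open>F i\<close>, which serve as second coordinates, and the codes of the copies
    that are placed on one-element parts.\<close>
  have "finite ((\<Union>i<k. univ (F i)) \<union> prod_encode ` (SIGMA i:{..<k}. {..<m i 0}))"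
    using F by (auto simp: is_graph_def is_struct_def)
  then obtain l where l: "\<And>x. x \<in> (\<Union>i<k. univ (F i)) \<union> prod_encode ` (SIGMA i:{..<k}. {..<m i 0}) \<Longrightarrow> x < l"
    unfolding finite_nat_set_iff_bounded by blast
  \<comment> \<open>The tournaments of a basic sequence must have non-constant size. If \<open>P i\<close> is constant, \<open>T_part i\<close>
    carries the empty graph and the copies of \<open>F i\<close> sit on the parts \<open>E_part (prod_encode (i, c))\<close>.\<close>
  define G where "G q = (case q of
      T_part i \<Rightarrow> if cst i then empty_graph else F i
    | E_part j \<Rightarrow> case prod_decode j of (i, c) \<Rightarrow>
        if i < k \<and> cst i \<and> c < m i 0 then F i else empty_graph)" for q
  have G: "\<forall>q\<in>parts k l. is_graph (G q) \<and> univ (G q) \<subseteq> {..<l}"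
  proof
    fix q assume that: "q \<in> parts k l"
    have "G q \<in> insert empty_graph (F ` {..<k})"
      using that by (auto simp: G_def parts_def split: prod.splits)
    then show "is_graph (G q) \<and> univ (G q) \<subseteq> {..<l}"
      using F is_graph_empty_graph l by (auto simp: empty_graph_def intro!: l)
  qed
  obtain I where I: "qf_interp_scheme graph_sig (basic_sig k l) I"
    "\<forall>N. univ (interpret_struct graph_sig I (basic_struct k l N))
      = {[(q, c), (E_part x, 1)] | q c x. (q, c) \<in> univ (basic_struct k l N) \<and> x \<in> univ (G q)}"
    "\<forall>N q c x q' c' y. (q, c) \<in> univ (basic_struct k l N) \<and> x \<in> univ (G q) \<and>
      (q', c') \<in> univ (basic_struct k l N) \<and> y \<in> univ (G q') \<longrightarrow>
      (adjacent (interpret_struct graph_sig I (basic_struct k l N))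
        [(q, c), (E_part x, 1)] [(q', c'), (E_part y, 1)]
      \<longleftrightarrow> (q, c) = (q', c') \<and> adjacent (G q) x y)"
    using scheme_of_part_graphs[OF G] by (elim exE conjE)
  \<comment> \<open>Where \<open>P i\<close> is constant, the tournament carries no vertices and
    only has to have non-constant polynomial size; \<open>n\<close> itself, that is
    \<open>[:0, 1:]\<close>, serves.\<close>
  define N where "N n i = (if cst i then n else m i n)" for n i
  define B where "B n = basic_struct k l (N n)" for n
  have "basic_sequence k l B"
    unfolding basic_sequence_def
    by (intro exI[of _ N] exI[of _ "\<lambda>i. if cst i then [:0, 1:] else P i"])
      (auto simp: B_def N_def m cst_def)
  moreover have "isomorphic graph_sig (A n) (interpret_struct graph_sig I (B n))" for n
  proof -
    let ?D = "disjoint_union {..<k} (\<lambda>i. copies (m i n) (F i))"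
    \<comment> \<open>\<open>pt i c\<close> is the point that selects the copy \<open>c\<close> of
      \<open>F i\<close>. Copies are numbered from 0 and tournament points from 1, hence
      \<open>Suc c\<close>.\<close>
    define pt where "pt i c = (if cst i then (E_part (prod_encode (i, c)), 1) else (T_part i, Suc c))" for i c
    define f where "f = (\<lambda>(i, c, x). [pt i c, (E_part x, 1)])"
    have D: "univ ?D = {(i, c, x). i < k \<and> c < m i n \<and> x \<in> univ (F i)}"
      by (auto simp: disjoint_union_def copies_def)
    have adjD: "adjacent ?D (i, c, x) (i', c', y) \<longleftrightarrow> i = i' \<and> c = c' \<and> adjacent (F i) x y"
      if "i < k" "c < m i n" for i c x i' c' y
      using that by (auto simp: adjacent_disjoint_union copies_def)
    have pt_inj: "pt i c = pt i' c' \<longleftrightarrow> i = i' \<and> c = c'" for i c i' c'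
      by (auto simp: pt_def)
    have pt_univ: "pt i c \<in> univ (B n)" and pt_G: "G (fst (pt i c)) = F i" if "i < k" "c < m i n" for i c
      using that m_cst[of i n] l[of "prod_encode (i, c)"] by (auto simp: pt_def B_def N_def G_def image_iff)
    \<comment> \<open>A vertex \<open>x\<close> of \<open>G q\<close> rules out the parts that carry
      \<open>empty_graph\<close>; every point of the other parts is a value of
      \<open>pt\<close>.\<close>
    have pt_surj: "\<exists>i<k. \<exists>c'<m i n. (q, c) = pt i c'" if "(q, c) \<in> univ (B n)" "x \<in> univ (G q)" for q c x
    proof (cases q)
      case (E_part j)
      obtain i c' where "prod_decode j = (i, c')" by fastforce
      then have j: "j = prod_encode (i, c')" by (metis prod_decode_inverse)
      have "i < k" "cst i" "c' < m i 0" "c = 1"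
        using that E_part j by (auto simp: G_def B_def empty_graph_def split: if_splits)
      then show ?thesis using E_part j m_cst[of i n] by (auto simp: pt_def)
    next
      case (T_part i)
      then have "i < k" "\<not> cst i" "1 \<le> c" "c \<le> m i n"
        using that by (auto simp: G_def B_def N_def empty_graph_def split: if_splits)
      then show ?thesis
        using T_part by (intro exI[of _ i] conjI exI[of _ "c - 1"]) (auto simp: pt_def)
    qed
    have "bij_betw f (univ ?D) (univ (interpret_struct graph_sig I (B n)))"
      unfolding bij_betw_def
    proof
      show "inj_on f (univ ?D)" by (auto simp: inj_on_def f_def pt_inj)
      show "f ` univ ?D = univ (interpret_struct graph_sig I (B n))"
      proof (intro equalityI subsetI)
        fix v assume "v \<in> f ` univ ?D"
        then obtain i c x where "i < k" "c < m i n" "x \<in> univ (F i)" "v = [pt i c, (E_part x, 1)]"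
          by (auto simp: D f_def)
        then show "v \<in> univ (interpret_struct graph_sig I (B n))"
          using pt_univ[of i c] pt_G[of i c] unfolding B_def I(2)[rule_format]
          by (cases "pt i c") (auto simp del: basic_univ)
      next
        fix v assume "v \<in> univ (interpret_struct graph_sig I (B n))"
        then obtain q c x where v: "v = [(q, c), (E_part x, 1)]" "(q, c) \<in> univ (B n)" "x \<in> univ (G q)"
          unfolding B_def I(2)[rule_format] by blast
        then obtain i c' where "i < k" "c' < m i n" "(q, c) = pt i c'" using pt_surj by blast
        then have "v = f (i, c', x)" "(i, c', x) \<in> univ ?D"
          using v pt_G[of i c'] by (auto simp: f_def D) (metis fst_conv)
        then show "v \<in> f ` univ ?D" by blast
      qed
    qed
    moreover have "adjacent ?D a b \<longleftrightarrow> adjacent (interpret_struct graph_sig I (B n)) (f a) (f b)"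
      if mem: "a \<in> univ ?D" "b \<in> univ ?D" for a b
    proof -
      obtain i c x where a: "a = (i, c, x)" "i < k" "c < m i n" "x \<in> univ (F i)"
        using mem(1) by (auto simp: D)
      obtain i' c' y where b: "b = (i', c', y)" "i' < k" "c' < m i' n" "y \<in> univ (F i')"
        using mem(2) by (auto simp: D)
      obtain q d where p: "pt i c = (q, d)" by fastforce
      obtain q' d' where p': "pt i' c' = (q', d')" by fastforce
      have "adjacent (interpret_struct graph_sig I (B n)) (f a) (f b) \<longleftrightarrow> (q, d) = (q', d') \<and> adjacent (G q) x y"
        using I(3)[rule_format, of q d "N n" x q' d' y] pt_univ[OF a(2,3)] pt_univ[OF b(2,3)]
          pt_G[OF a(2,3)] pt_G[OF b(2,3)] a(4) b(4) p p'
        unfolding a b f_def B_def by (simp del: basic_univ)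
      also have "\<dots> \<longleftrightarrow> adjacent ?D a b"
        using pt_inj[of i c i' c'] pt_G[OF a(2,3)] p p' adjD[OF a(2,3)] unfolding a(1) b(1) by auto
      finally show ?thesis by simp
    qed
    ultimately have "isomorphic graph_sig ?D (interpret_struct graph_sig I (B n))"
      by (rule isomorphic_graph_sig_I)
    then show ?thesis using iso isomorphic_trans by blast
  qed
  ultimately show ?thesis
    unfolding qf_interpretation_of_basic_sequence_def using I(1) by blast
qed

section \<open>Components of strongly polynomial sequences of bounded degree\<close>

lemma poly_map_poly_of_rat:
  "poly (map_poly of_rat p) (of_rat x) = (of_rat (poly p x) :: real)"
  by (induction p) (simp_all add: map_poly_pCons of_rat_add of_rat_mult)

text \<open>If \<open>P\<close> had the larger degree, the quotient of \<open>Q\<close> by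
  \<open>P\<close> would tend to 0, whereas the inequality keeps its absolute value above a positive
  constant. The polynomials are moved to the reals for the limit.\<close>

lemma degree_le_if_bounded_by:
  fixes P Q :: "rat poly"
  assumes "\<And>n :: nat. 0 \<le> poly P (of_nat n)"
    and "\<And>n :: nat. poly P (of_nat n) \<le> c * poly Q (of_nat n)"
  shows "degree P \<le> degree Q"
proof (rule ccontr)
  assume deg: "\<not> degree P \<le> degree Q"
  define p q :: "real poly" where "p = map_poly of_rat P" and "q = map_poly of_rat Q"
  have "degree q < degree p"
    using deg by (simp add: p_def q_def degree_map_poly)
  then have "((\<lambda>x. poly q x / poly p x) \<longlongrightarrow> 0) at_infinity"
    by (rule poly_divide_tendsto_0_at_infinity)
  then have lim: "(\<lambda>n. poly q (real n) / poly p (real n)) \<longlonglongrightarrow> 0"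
    by (rule filterlim_compose[OF _ filterlim_real_at_infinity_sequentially])
  have P_of: "poly p (real n) = of_rat (poly P (of_nat n))" "poly q (real n) = of_rat (poly Q (of_nat n))" for n
    unfolding p_def q_def by (metis of_rat_of_nat_eq poly_map_poly_of_rat)+
  \<comment> \<open>Adding 1 keeps \<open>C\<close> positive also for \<open>c = 0\<close>, so that
    \<open>1 / C\<close> can serve as a threshold.\<close>
  define C :: real where "C = \<bar>of_rat c\<bar> + 1"
  have "C > 0" unfolding C_def by (rule add_nonneg_pos) (simp_all only: abs_ge_zero zero_less_one)
  then have "eventually (\<lambda>n. \<bar>poly q (real n) / poly p (real n)\<bar> < 1 / C) sequentially"
    using lim by (auto simp: tendsto_iff dist_real_def)
  then obtain n0 where n0: "\<And>n. n \<ge> n0 \<Longrightarrow> \<bar>poly q (real n) / poly p (real n)\<bar> < 1 / C"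
    by (auto simp: eventually_sequentially)
  have "P \<noteq> 0" using deg by auto
  then have "finite {x. poly P x = 0}" by (rule poly_roots_finite)
  then have "finite (of_nat -` {x. poly P x = 0} :: nat set)"
    by (rule finite_vimageI) (simp add: inj_on_def)
  \<comment> \<open>Such an \<open>n\<close> exists because \<open>P\<close> has finitely many
    roots; there \<open>P\<close> is positive and the inequality can be divided by its
    value.\<close>
  then obtain n where n: "n \<ge> n0" "n \<notin> of_nat -` {x. poly P x = 0}"
    by (metis finite_nat_set_iff_bounded_le nat_le_linear not_less_eq_eq)
  have "poly P (of_nat n) > 0" using n(2) assms(1)[of n] by auto
  then have p: "poly p (real n) > 0" by (simp add: P_of)
  have "poly p (real n) \<le> of_rat c * poly q (real n)"
    unfolding P_of using assms(2)[of n] by (simp add: of_rat_mult[symmetric] of_rat_less_eq)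
  also have "\<dots> \<le> \<bar>of_rat c\<bar> * \<bar>poly q (real n)\<bar>" by (metis abs_ge_self abs_mult)
  also have "\<dots> \<le> C * \<bar>poly q (real n)\<bar>" by (rule mult_right_mono) (simp_all add: C_def)
  finally have "1 / C \<le> \<bar>poly q (real n) / poly p (real n)\<bar>"
    using p \<open>C > 0\<close> by (simp add: abs_divide field_simps)
  then show False using n0[OF n(1)] by simp
qed

lemma strongly_polynomial_count:
  fixes A :: "nat \<Rightarrow> ('s, 'a) rstruct"
  assumes "strongly_polynomial \<sigma> A" "qf_definable \<sigma> r (\<Psi> :: ('s, 'a) rstruct \<Rightarrow> _)"
  shows "polynomial_fun (\<lambda>n. of_nat (card {v. length v = r \<and> set v \<subseteq> univ (A n) \<and> \<Psi> (A n) v}))"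
proof -
  obtain \<phi> where \<phi>: "formula \<sigma> r \<phi>" "quantifier_free \<phi>"
    "\<And>(B :: ('s, 'a) rstruct) v. length v = r \<Longrightarrow> holds_at B \<phi> v \<longleftrightarrow> \<Psi> B v"
    using qf_definable_formula[OF assms(2)] by metis
  have "answers r \<phi> (A n) = {v. length v = r \<and> set v \<subseteq> univ (A n) \<and> \<Psi> (A n) v}" for n
    using \<phi>(3) by (auto simp: answers_def)
  moreover have "\<exists>P :: rat poly. \<forall>n. of_nat (card (answers r \<phi> (A n))) = poly P (of_nat n)"
    using assms(1) \<phi>(1,2) unfolding strongly_polynomial_def by blast
  ultimately show ?thesis by (simp add: polynomial_fun_def)
qed

lemma qf_definable_adjacent:
  assumes "i < r" "j < r"
  shows "qf_definable graph_sig r (\<lambda>G v. adjacent G (v ! i) (v ! j))"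
  using qf_definable_rel[of Adj graph_sig "[i, j]" r] assms by (simp add: graph_sig_def adjacent_def)

lemma qf_definable_cong:
  assumes "qf_definable \<sigma> r \<Psi>" "\<And>A v. length v = r \<Longrightarrow> \<Psi> A v \<longleftrightarrow> \<Phi> A v"
  shows "qf_definable \<sigma> r \<Phi>"
  using assms unfolding qf_definable_def by metis

lemma qf_definable_distinct: "qf_definable \<sigma> r (\<lambda>A v. distinct v)"
proof (rule qf_definable_cong)
  show "qf_definable \<sigma> r (\<lambda>A v. \<forall>i\<in>{..<r}. \<forall>j\<in>{..<i}. \<not> v ! i = v ! j)"
    by (intro qf_definable_ball qf_definable_not qf_definable_eq) auto
  show "(\<forall>i\<in>{..<r}. \<forall>j\<in>{..<i}. \<not> v ! i = v ! j) \<longleftrightarrow> distinct v" if "length v = r" for A v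
    using that by (auto simp: distinct_conv_nth) (metis lessThan_iff linorder_neqE_nat)
qed

section \<open>Tree lists and the bound on their length\<close>

definition pattern :: "'a graph \<Rightarrow> 'a list \<Rightarrow> (nat \<times> nat) set" where
  "pattern G v = {(i, j). i < length v \<and> j < length v \<and> adjacent G (v ! i) (v ! j)}"

text \<open>The earlier neighbour certifies connectedness by a condition on positions, which for
  each fixed length is quantifier-free.\<close>

definition tree_list :: "'a graph \<Rightarrow> 'a list \<Rightarrow> bool" where
  "tree_list G v \<longleftrightarrow> v \<noteq> [] \<and> distinct v \<and> set v \<subseteq> univ G \<and>
     (\<forall>i\<in>{0<..<length v}. \<exists>j<i. adjacent G (v ! j) (v ! i))"

definition boundary :: "'a graph \<Rightarrow> 'a set \<Rightarrow> 'a set" where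
  "boundary G C = {w \<in> univ G - C. \<exists>x\<in>C. adjacent G x w}"

lemma tree_list_singleton: "x \<in> univ G \<Longrightarrow> tree_list G [x]"
  by (simp add: tree_list_def)

lemma tree_list_append:
  assumes "tree_list G v" "w \<in> boundary G (set v)"
  shows "tree_list G (v @ [w])"
proof -
  obtain j where "j < length v" "adjacent G (v ! j) w"
    using assms(2) by (auto simp: boundary_def in_set_conv_nth)
  then have "\<exists>j<i. adjacent G ((v @ [w]) ! j) ((v @ [w]) ! i)" if i: "i \<in> {0<..<length (v @ [w])}" for i
  proof (cases "i = length v")
    case True
    then show ?thesis using \<open>j < length v\<close> \<open>adjacent G (v ! j) w\<close>
      by (intro exI[of _ j]) (simp add: nth_append)
  next
    case False
    then have "i \<in> {0<..<length v}" using i by auto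
    then obtain j' where "j' < i" "adjacent G (v ! j') (v ! i)" "i < length v"
      using assms(1) unfolding tree_list_def by (metis greaterThanLessThan_iff)
    then show ?thesis by (intro exI[of _ j']) (simp add: nth_append)
  qed
  then show ?thesis using assms by (auto simp: tree_list_def boundary_def)
qed

lemma tree_list_snocD:
  assumes "tree_list G (v @ [w])" "v \<noteq> []"
  shows "tree_list G v" "w \<in> boundary G (set v)"
proof -
  have *: "\<exists>j<i. adjacent G ((v @ [w]) ! j) ((v @ [w]) ! i)" if "0 < i" "i \<le> length v" for i
    using assms(1) that by (auto simp: tree_list_def)
  have "\<exists>j<i. adjacent G (v ! j) (v ! i)" if "0 < i" "i < length v" for i
    using *[of i] that by (auto simp: nth_append)
  then show "tree_list G v" using assms by (auto simp: tree_list_def)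
  obtain j where "j < length v" "adjacent G (v ! j) w"
    using *[of "length v"] assms(2) by (auto simp: nth_append)
  then show "w \<in> boundary G (set v)" using assms(1) by (auto simp: boundary_def tree_list_def)
qed

lemma finite_tree_lists: "finite (univ G) \<Longrightarrow> finite {v. tree_list G v \<and> length v = r}"
  by (rule finite_subset[OF _ finite_lists_length_eq[of "univ G" r]]) (auto simp: tree_list_def)

lemma card_boundary_le:
  assumes "finite (univ G)" "\<And>x. x \<in> univ G \<Longrightarrow> vertex_degree G x \<le> D" "set v \<subseteq> univ G"
  shows "card (boundary G (set v)) \<le> length v * D"
proof -
  have "boundary G (set v) \<subseteq> (\<Union>x\<in>set v. {w \<in> univ G. adjacent G x w})"
    by (auto simp: boundary_def)
  then have "card (boundary G (set v)) \<le> card (\<Union>x\<in>set v. {w \<in> univ G. adjacent G x w})"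
    using assms(1) by (intro card_mono) auto
  also have "\<dots> \<le> (\<Sum>x\<in>set v. vertex_degree G x)"
    unfolding vertex_degree_def by (rule card_UN_le) simp
  also have "\<dots> \<le> (\<Sum>x\<in>set v. D)" using assms(2,3) by (intro sum_mono) auto
  also have "\<dots> \<le> length v * D" by (simp add: card_length)
  finally show ?thesis .
qed

text \<open>The last entry of a tree list of length \<open>Suc r\<close> lies in the boundary of the
  first \<open>r\<close> entries, and this boundary has at most \<open>r * D\<close> points.\<close>

lemma card_tree_lists_Suc:
  assumes "finite (univ G)" "\<And>x. x \<in> univ G \<Longrightarrow> vertex_degree G x \<le> D" "0 < r"
  shows "card {v. tree_list G v \<and> length v = Suc r} \<le> card {v. tree_list G v \<and> length v = r} * (r * D)"
proof -
  let ?T = "\<lambda>r. {v. tree_list G v \<and> length v = r}"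
  have "?T (Suc r) \<subseteq> (\<lambda>(v, w). v @ [w]) ` (SIGMA v:?T r. boundary G (set v))"
  proof
    fix u assume u: "u \<in> ?T (Suc r)"
    then obtain v w where vw: "u = v @ [w]" by (cases u rule: rev_cases) auto
    then show "u \<in> (\<lambda>(v, w). v @ [w]) ` (SIGMA v:?T r. boundary G (set v))"
      using u assms(3) tree_list_snocD[of G v w] by force
  qed
  moreover have fin: "finite (?T r)" "\<forall>v\<in>?T r. finite (boundary G (set v))"
    using assms(1) finite_tree_lists by (auto simp: boundary_def)
  ultimately have "card (?T (Suc r)) \<le> card (SIGMA v:?T r. boundary G (set v))"
    by (intro surj_card_le[where f = "\<lambda>(v, w). v @ [w]"]) (auto intro!: finite_SigmaI)
  also have "\<dots> = (\<Sum>v\<in>?T r. card (boundary G (set v)))"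
    using fin by (rule card_SigmaI)
  also have "\<dots> \<le> (\<Sum>v\<in>?T r. r * D)"
    using card_boundary_le[OF assms(1,2)] by (intro sum_mono) (fastforce simp: tree_list_def)
  finally show ?thesis by simp
qed

lemma card_tree_lists_le:
  assumes "finite (univ G)" "\<And>x. x \<in> univ G \<Longrightarrow> vertex_degree G x \<le> D"
  shows "card {v. tree_list G v \<and> length v = Suc r} \<le> card (univ G) * (\<Prod>i\<in>{1..r}. i * D)"
proof (induction r)
  case 0
  have "{v. tree_list G v \<and> length v = Suc 0} \<subseteq> (\<lambda>x. [x]) ` univ G"
    by (auto simp: tree_list_def length_Suc_conv)
  then show ?case using assms(1) by (simp add: surj_card_le)
next
  case (Suc r)
  have "card {v. tree_list G v \<and> length v = Suc (Suc r)}
      \<le> card {v. tree_list G v \<and> length v = Suc r} * (Suc r * D)"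
    using assms by (intro card_tree_lists_Suc) auto
  also have "\<dots> \<le> card (univ G) * (\<Prod>i\<in>{1..r}. i * D) * (Suc r * D)"
    using Suc.IH by (rule mult_right_mono) simp
  finally show ?case by (simp add: mult.assoc del: mult_Suc)
qed

lemma tree_list_length_bounded:
  fixes A :: "nat \<Rightarrow> 'a graph"
  assumes sp: "strongly_polynomial graph_sig A" and fin: "\<And>n. finite (univ (A n))"
    and deg: "\<And>n x. x \<in> univ (A n) \<Longrightarrow> vertex_degree (A n) x \<le> D"
  obtains K where "\<And>n v. tree_list (A n) v \<Longrightarrow> length v < K"
proof -
  let ?T = "\<lambda>r n. {v. tree_list (A n) v \<and> length v = r}"
  have poly_T: "polynomial_fun (\<lambda>n. of_nat (card (?T r n)))" if "0 < r" for r
  proof -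
    have "qf_definable graph_sig r (\<lambda>G v. distinct v \<and>
        (\<forall>i\<in>{0<..<r}. \<exists>j\<in>{..<i}. adjacent G (v ! j) (v ! i)))"
      by (intro qf_definable_conj qf_definable_distinct qf_definable_ball qf_definable_bex
          qf_definable_adjacent) auto
    from strongly_polynomial_count[OF sp this]
    show ?thesis
      by (rule back_subst[of polynomial_fun])
        (use that in \<open>auto intro!: arg_cong[of _ _ card] simp: tree_list_def fun_eq_iff\<close>)
  qed
  obtain Q :: "rat poly" where Q: "\<And>n. of_nat (card (univ (A n))) = poly Q (of_nat n)"
  proof -
    \<comment> \<open>The vertices are counted by the true formula in one variable.\<close>
    have "{v. length v = Suc 0 \<and> set v \<subseteq> univ (A n) \<and> True} = (\<lambda>x. [x]) ` univ (A n)" for n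
      by (auto simp: length_Suc_conv)
    then have "card {v. length v = Suc 0 \<and> set v \<subseteq> univ (A n) \<and> True} = card (univ (A n))" for n
      by (simp add: card_image inj_on_def)
    then show thesis
      using strongly_polynomial_count[OF sp qf_definable_const[of _ "Suc 0" True]] that
      by (auto simp: polynomial_fun_def)
  qed
  \<comment> \<open>\<open>r\<close> is the largest order among the graphs with index at most
    \<open>degree Q\<close>, so none of these contains \<open>Suc r\<close> distinct
    vertices.\<close>
  define r where "r = Max ((\<lambda>n. card (univ (A n))) ` {..degree Q})"
  have small: "?T (Suc r) n = {}" if "n \<le> degree Q" for n
  proof -
    have "length v \<le> r" if "tree_list (A n) v" for v
    proof -
      have "length v = card (set v)" using that by (simp add: tree_list_def distinct_card)
      also have "\<dots> \<le> card (univ (A n))" using that fin by (auto simp: tree_list_def intro: card_mono)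
      also have "\<dots> \<le> r" unfolding r_def using \<open>n \<le> degree Q\<close> by (intro Max_ge) auto
      finally show ?thesis .
    qed
    then show ?thesis by fastforce
  qed
  obtain P :: "rat poly" where P: "\<And>n. of_nat (card (?T (Suc r) n)) = poly P (of_nat n)"
    using poly_T[of "Suc r"] by (auto simp: polynomial_fun_def)
  have "degree P \<le> degree Q"
  proof (rule degree_le_if_bounded_by)
    show "0 \<le> poly P (of_nat n)" for n using P[of n] by (metis of_nat_0_le_iff)
    show "poly P (of_nat n) \<le> of_nat (\<Prod>i\<in>{1..r}. i * D) * poly Q (of_nat n)" for n
      unfolding P[symmetric] Q[symmetric] of_nat_mult[symmetric] of_nat_le_iff
      using card_tree_lists_le[of "A n" D r, OF fin deg] by (simp only: mult.commute)
  qed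
  \<comment> \<open>\<open>P\<close> has the \<open>degree Q + 1\<close> zeros
    \<open>0, ..., degree Q\<close>, more than its degree allows for a nonzero polynomial.\<close>
  have "P = 0"
  proof (rule ccontr)
    assume "P \<noteq> 0"
    have "poly P (of_nat n) = 0" if "n \<le> degree Q" for n
      unfolding P[symmetric] small[OF that] by simp
    then have "card (of_nat ` {..degree Q} :: rat set) \<le> card {x. poly P x = 0}"
      using poly_roots_finite[OF \<open>P \<noteq> 0\<close>] by (intro card_mono) auto
    also have "\<dots> \<le> degree P" by (rule card_poly_roots_bound[OF \<open>P \<noteq> 0\<close>])
    finally show False using \<open>degree P \<le> degree Q\<close> by (simp add: card_image inj_on_def)
  qed
  then have "card (?T (Suc r) n) = 0" for n using P[of n] by simp
  \<comment> \<open>When one length admits no tree list, neither does the next, since the count for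
    the next length is at most a multiple of 0.\<close>
  have "card (?T (Suc r + s) n) = 0" for s n
  proof (induction s)
    case 0
    show ?case using \<open>card (?T (Suc r) n) = 0\<close> by simp
  next
    case (Suc s)
    then show ?case using card_tree_lists_Suc[of "A n" D "Suc r + s", OF fin deg] by simp
  qed
  then have empty: "?T (Suc r + s) n = {}" for s n
    using finite_tree_lists[OF fin, of n "Suc r + s"] by (metis card_0_eq)
  have "length v < Suc r" if "tree_list (A n) v" for n v
  proof (rule ccontr)
    assume "\<not> length v < Suc r"
    then have "v \<in> ?T (Suc r + (length v - Suc r)) n" using that by simp
    then show False unfolding empty by simp
  qed
  then show thesis by (rule that)
qed

section \<open>Inclusion-exclusion over boundary points\<close>

lemma alternating_binomial_sum:
  assumes "x \<le> m"
  shows "(\<Sum>i\<le>m. (-1) ^ i * of_nat (x choose i) :: rat) = (if x = 0 then 1 else 0)"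
proof -
  \<comment> \<open>The terms with \<open>i > x\<close> vanish, so one cutoff \<open>m\<close>
    serves every \<open>x \<le> m\<close>; what remains is the expansion of
    \<open>(1 - 1) ^ x\<close>.\<close>
  have "(\<Sum>i\<le>m. (-1) ^ i * of_nat (x choose i) :: rat) = (\<Sum>i\<le>x. (-1) ^ i * of_nat (x choose i))"
    using assms by (intro sum.mono_neutral_right) (auto simp: binomial_eq_0)
  also have "\<dots> = (if x = 0 then 1 else 0)"
    using choose_alternating_sum[of x, where 'a = rat] by auto
  finally show ?thesis .
qed

text \<open>Formulas count ordered tuples, whereas inclusion-exclusion runs over subsets; each
  subset of size \<open>i\<close> has \<open>fact i\<close> orderings.\<close>

lemma card_distinct_lists:
  assumes "finite S"
  shows "card {ws. length ws = i \<and> distinct ws \<and> set ws \<subseteq> S} = fact i * (card S choose i)"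
proof (cases "i \<le> card S")
  case True
  have "\<Prod>{card S - i + 1..card S} = fact (card S) div fact (card S - i)"
    by (simp add: fact_div_fact)
  also have "\<dots> = fact i * (card S choose i)"
    using binomial_fact_lemma[OF True] by (metis fact_nonzero mult.assoc mult.commute nonzero_mult_div_cancel_left)
  finally have "\<Prod>{card S - i + 1..card S} = fact i * (card S choose i)" .
  then show ?thesis
    using card_lists_distinct_length_eq[OF assms True] by simp
next
  case False
  then have empty: "{ws. length ws = i \<and> distinct ws \<and> set ws \<subseteq> S} = {}"
    using assms by (auto dest!: card_mono[OF assms] simp: distinct_card)
  show ?thesis unfolding empty using False by (simp add: binomial_eq_0)
qed

text \<open>Phrases the pattern of the first \<open>p\<close> entries as a condition on positions of
  the longer list, the form in which a formula can state it.\<close>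

lemma pattern_append:
  assumes "length v = p" "E \<subseteq> {..<p} \<times> {..<p}"
  shows "pattern G v = E \<longleftrightarrow>
    (\<forall>a\<in>{..<p}. \<forall>b\<in>{..<p}. adjacent G ((v @ ws) ! a) ((v @ ws) ! b) \<longleftrightarrow> (a, b) \<in> E)"
  using assms by (auto simp: pattern_def nth_append set_eq_iff)

text \<open>The lists satisfying \<open>\<Psi> i\<close> consist of a tree list with pattern \<open>E\<close> and \<open>i\<close> further points of its
  boundary; the alternating sum over \<open>i\<close> singles out the tree lists with empty boundary.\<close>

lemma polynomial_fun_card_closed_tree_lists:
  fixes A :: "nat \<Rightarrow> 'a graph"
  assumes sp: "strongly_polynomial graph_sig A" and fin: "\<And>n. finite (univ (A n))"
    and deg: "\<And>n x. x \<in> univ (A n) \<Longrightarrow> vertex_degree (A n) x \<le> D"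
    and E: "E \<subseteq> {..<p} \<times> {..<p}" and p: "0 < p"
  shows "polynomial_fun (\<lambda>n. of_nat (card {v. tree_list (A n) v \<and> boundary (A n) (set v) = {} \<and>
    length v = p \<and> pattern (A n) v = E}))"
proof -
  define \<Psi> :: "nat \<Rightarrow> 'a graph \<Rightarrow> 'a list \<Rightarrow> bool" where
    "\<Psi> i G u \<longleftrightarrow> distinct u \<and> (\<forall>a\<in>{0<..<p}. \<exists>b\<in>{..<a}. adjacent G (u ! b) (u ! a)) \<and>
       (\<forall>a\<in>{..<p}. \<forall>b\<in>{..<p}. adjacent G (u ! a) (u ! b) \<longleftrightarrow> (a, b) \<in> E) \<and>
       (\<forall>b\<in>{..<i}. \<exists>a\<in>{..<p}. adjacent G (u ! a) (u ! (p + b)))" for i G u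
  define U where "U i n = {u. length u = p + i \<and> set u \<subseteq> univ (A n) \<and> \<Psi> i (A n) u}" for i n
  define V where "V n = {v. tree_list (A n) v \<and> length v = p \<and> pattern (A n) v = E}" for n
  define W where "W i n v = {ws. length ws = i \<and> distinct ws \<and> set ws \<subseteq> boundary (A n) (set v)}" for i n v
  have \<Psi>: "qf_definable graph_sig (p + i) (\<Psi> i)" for i
    unfolding \<Psi>_def
    by (intro qf_definable_conj qf_definable_distinct qf_definable_ball qf_definable_bex
        qf_definable_iff qf_definable_adjacent) auto
  have finV: "finite (V n)" for n
    by (rule finite_subset[OF _ finite_tree_lists[OF fin[of n], of p]]) (auto simp: V_def)
  have finB: "finite (boundary (A n) C)" for n C using fin by (simp add: boundary_def)
  have finW: "finite (W i n v)" for i n v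
    by (rule rev_finite_subset[OF finite_lists_length_eq[OF finB[of n "set v"], of i]]) (auto simp: W_def)
  \<comment> \<open>Distinctness of the whole list makes \<open>ws\<close> avoid \<open>v\<close>,
    and the last clause of \<open>\<Psi>\<close> gives each entry of \<open>ws\<close> a neighbour
    in \<open>v\<close>; together this places \<open>ws\<close> in the boundary of
    \<open>set v\<close>.\<close>
  have \<Psi>_append: "set (v @ ws) \<subseteq> univ (A n) \<and> \<Psi> i (A n) (v @ ws) \<longleftrightarrow> v \<in> V n \<and> ws \<in> W i n v"
    if len: "length v = p" "length ws = i" for v ws i n
  proof -
    have "(\<forall>a\<in>{0<..<p}. \<exists>b\<in>{..<a}. adjacent (A n) ((v @ ws) ! b) ((v @ ws) ! a)) \<longleftrightarrow>
        (\<forall>a\<in>{0<..<length v}. \<exists>b<a. adjacent (A n) (v ! b) (v ! a))"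
      using len by (auto simp: nth_append)
    moreover have "set v = (!) v ` {..<p}" using len by (auto simp: set_conv_nth)
    then have "(\<exists>a\<in>{..<p}. adjacent (A n) ((v @ ws) ! a) ((v @ ws) ! (p + b))) \<longleftrightarrow>
        (\<exists>x\<in>set v. adjacent (A n) x (ws ! b))" for b
      using len by (auto simp: nth_append)
    then have "(\<forall>b\<in>{..<i}. \<exists>a\<in>{..<p}. adjacent (A n) ((v @ ws) ! a) ((v @ ws) ! (p + b))) \<longleftrightarrow>
        (\<forall>w\<in>set ws. \<exists>x\<in>set v. adjacent (A n) x w)"
      unfolding all_set_conv_all_nth using len by auto
    moreover have "v \<noteq> []" using len p by auto
    ultimately show ?thesis
      unfolding \<Psi>_def pattern_append[OF len(1) E, of "A n" ws, symmetric]
      using len by (auto simp: V_def W_def tree_list_def boundary_def)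
  qed
  have "U i n = (\<lambda>(v, ws). v @ ws) ` (SIGMA v:V n. W i n v)" for i n
  proof (intro equalityI subsetI)
    fix u assume u: "u \<in> U i n"
    then have "take p u \<in> V n \<and> drop p u \<in> W i n (take p u)"
      using \<Psi>_append[of "take p u" "drop p u" i n] by (simp add: U_def)
    then show "u \<in> (\<lambda>(v, ws). v @ ws) ` (SIGMA v:V n. W i n v)"
      by (intro image_eqI[of _ _ "(take p u, drop p u)"]) auto
  next
    fix u assume "u \<in> (\<lambda>(v, ws). v @ ws) ` (SIGMA v:V n. W i n v)"
    then obtain v ws where "v \<in> V n" "ws \<in> W i n v" "u = v @ ws" by auto
    then show "u \<in> U i n"
      using \<Psi>_append[of v ws i n] by (auto simp: U_def V_def W_def)
  qed
  moreover have "inj_on (\<lambda>(v, ws). v @ ws) (SIGMA v:V n. W i n v)" for i n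
    by (auto simp: inj_on_def V_def)
  ultimately have "card (U i n) = card (SIGMA v:V n. W i n v)" for i n
    by (simp add: card_image)
  also have "card (SIGMA v:V n. W i n v) = (\<Sum>v\<in>V n. card (W i n v))" for i n
    using finV finW by (intro card_SigmaI) auto
  finally have card_U: "card (U i n) = fact i * (\<Sum>v\<in>V n. card (boundary (A n) (set v)) choose i)" for i n
    by (simp add: W_def card_distinct_lists[OF finB] sum_distrib_left)
  \<comment> \<open>Division by \<open>fact i\<close> passes from lists of boundary points to sets.
    Every boundary has at most \<open>p * D\<close> points, so the same range of \<open>i\<close>
    works for all \<open>n\<close>.\<close>
  have "(\<Sum>i\<le>p * D. (-1) ^ i / fact i * of_nat (card (U i n)) :: rat)
      = of_nat (card {v \<in> V n. boundary (A n) (set v) = {}})" for n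
  proof -
    let ?b = "\<lambda>v. card (boundary (A n) (set v))"
    have b: "?b v \<le> p * D" if "v \<in> V n" for v
      using card_boundary_le[of "A n" D v, OF fin deg] that by (auto simp: V_def tree_list_def)
    have "(\<Sum>i\<le>p * D. (-1) ^ i / fact i * of_nat (card (U i n)) :: rat)
        = (\<Sum>i\<le>p * D. \<Sum>v\<in>V n. (-1) ^ i * of_nat (?b v choose i))"
      by (intro sum.cong refl) (simp add: card_U sum_distrib_left)
    also have "\<dots> = (\<Sum>v\<in>V n. \<Sum>i\<le>p * D. (-1) ^ i * of_nat (?b v choose i))"
      by (rule sum.swap)
    also have "\<dots> = (\<Sum>v\<in>V n. if boundary (A n) (set v) = {} then 1 else 0)"
      using b finB by (intro sum.cong refl) (simp add: alternating_binomial_sum)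
    also have "\<dots> = of_nat (card {v \<in> V n. boundary (A n) (set v) = {}})"
      using finV by (simp add: sum.If_cases Int_def)
    finally show ?thesis .
  qed
  moreover have "polynomial_fun (\<lambda>n. \<Sum>i\<le>p * D. (-1) ^ i / fact i * of_nat (card (U i n)))"
    using strongly_polynomial_count[OF sp \<Psi>]
    by (intro polynomial_fun_sum polynomial_fun_mult polynomial_fun_const) (simp add: U_def)
  moreover have "{v \<in> V n. boundary (A n) (set v) = {}}
      = {v. tree_list (A n) v \<and> boundary (A n) (set v) = {} \<and> length v = p \<and> pattern (A n) v = E}" for n
    by (auto simp: V_def)
  ultimately show ?thesis by simp
qed

section \<open>Components and their isomorphism types\<close>

definition components :: "'a graph \<Rightarrow> 'a set set" where
  "components G = {set v | v. tree_list G v \<and> boundary G (set v) = {}}"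

text \<open>The codes of all tree-list enumerations of \<open>C\<close>. A single common code makes
  two induced graphs isomorphic, and then all their codes agree.\<close>

definition types :: "'a graph \<Rightarrow> 'a set \<Rightarrow> (nat \<times> (nat \<times> nat) set) set" where
  "types G C = {(length v, pattern G v) | v. tree_list G v \<and> set v = C}"

lemma boundary_eq_emptyD:
  assumes "is_graph G" "boundary G C = {}" "x \<in> C" "adjacent G x y"
  shows "y \<in> C"
proof -
  have "y \<in> univ G" using assms(1,4) by (fastforce simp: is_graph_def is_struct_def adjacent_def graph_sig_def)
  then show ?thesis using assms by (auto simp: boundary_def)
qed

text \<open>Membership in \<open>C\<close> travels along the links to earlier neighbours: from
  \<open>x\<close> back to the first entry, using symmetry, and from there forward to every
  entry.\<close>

lemma tree_list_subset_closed:
  assumes G: "is_graph G" and C: "boundary G C = {}" and v: "tree_list G v" and x: "x \<in> set v" "x \<in> C"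
  shows "set v \<subseteq> C"
proof -
  have sym: "adjacent G b a" if "adjacent G a b" for a b using G that by (simp add: is_graph_def)
  have parent: "\<exists>j<i. adjacent G (v ! j) (v ! i)" if "0 < i" "i < length v" for i
    using v that by (simp add: tree_list_def)
  have root: "v ! 0 \<in> C" if "i < length v" "v ! i \<in> C" for i
    using that
  proof (induction i rule: less_induct)
    case (less i)
    show ?case
    proof (cases "i = 0")
      case False
      then obtain j where "j < i" "adjacent G (v ! j) (v ! i)" using parent less.prems by blast
      then show ?thesis
        using less boundary_eq_emptyD[OF G C less.prems(2) sym] by force
    qed (use less in simp)
  qed
  have "v ! i \<in> C" if "i < length v" for i
    using that
  proof (induction i rule: less_induct)
    case (less i)
    show ?case
    proof (cases "i = 0")
      case True
      then show ?thesis using root x by (auto simp: in_set_conv_nth)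
    next
      case False
      then obtain j where "j < i" "adjacent G (v ! j) (v ! i)" using parent less.prems by blast
      then show ?thesis using less boundary_eq_emptyD[OF G C] by force
    qed
  qed
  then show ?thesis by (auto simp: in_set_conv_nth)
qed

lemma components_eqI:
  assumes "is_graph G" "C \<in> components G" "C' \<in> components G" "x \<in> C" "x \<in> C'"
  shows "C = C'"
  using assms tree_list_subset_closed[OF assms(1)] unfolding components_def by blast

text \<open>A longest tree list through \<open>x\<close> has empty boundary, because a boundary
  point could be appended to it.\<close>

lemma ex_component:
  assumes G: "is_graph G" and x: "x \<in> univ G"
  obtains C where "C \<in> components G" "x \<in> C"
proof -
  have fin: "finite (univ G)" using G by (simp add: is_graph_def is_struct_def)
  have bound: "\<forall>v. tree_list G v \<and> x \<in> set v \<longrightarrow> length v < Suc (card (univ G))"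
    using fin by (metis card_mono distinct_card tree_list_def le_imp_less_Suc)
  have "tree_list G [x] \<and> x \<in> set [x]" using tree_list_singleton[OF x] by simp
  from ex_has_greatest_nat[of "\<lambda>v. tree_list G v \<and> x \<in> set v", OF this bound]
  obtain v where v: "tree_list G v \<and> x \<in> set v"
    "\<forall>u. tree_list G u \<and> x \<in> set u \<longrightarrow> length u \<le> length v"
    by blast
  have "boundary G (set v) = {}"
  proof (rule ccontr)
    assume "boundary G (set v) \<noteq> {}"
    then obtain w where "w \<in> boundary G (set v)" by blast
    then have "tree_list G (v @ [w]) \<and> x \<in> set (v @ [w])" using tree_list_append v(1) by auto
    then show False using v(2) by fastforce
  qed
  then show thesis using v(1) that[of "set v"] by (auto simp: components_def)
qed

lemma types_nonempty: "C \<in> components G \<Longrightarrow> types G C \<noteq> {}"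
  by (auto simp: components_def types_def)

text \<open>The isomorphism sends the \<open>i\<close>-th entry of \<open>v\<close> to the
  \<open>i\<close>-th entry of \<open>w\<close>. It is well defined because \<open>v\<close> is
  distinct, and it respects adjacency because the patterns agree.\<close>

lemma pattern_isoE:
  assumes "tree_list G v" "tree_list H w" "length v = length w" "pattern G v = pattern H w"
  obtains g where "inj_on g (set v)" "g ` set v = set w"
    "\<And>u. set u \<subseteq> set v \<Longrightarrow> pattern H (map g u) = pattern G u"
    "\<And>u. set u \<subseteq> set v \<Longrightarrow> tree_list G u \<Longrightarrow> tree_list H (map g u)"
proof -
  define g where "g x = w ! inv_into {..<length v} ((!) v) x" for x
  have dist: "distinct v" "distinct w" "set w \<subseteq> univ H" using assms(1,2) by (auto simp: tree_list_def)
  have inj: "inj_on ((!) v) {..<length v}" using dist(1) by (simp add: inj_on_nth)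
  have g: "g (v ! i) = w ! i" if "i < length v" for i
    using inv_into_f_f[OF inj, of i] that by (simp add: g_def)
  have inj_g: "inj_on g (set v)"
    using g assms(3) dist by (auto simp: inj_on_def in_set_conv_nth nth_eq_iff_index_eq)
  have "map g v = w" using g assms(3) by (auto intro: nth_equalityI)
  then have img: "g ` set v = set w" by (metis list.set_map)
  have adj: "adjacent H (g x) (g y) \<longleftrightarrow> adjacent G x y" if xy: "x \<in> set v" "y \<in> set v" for x y
  proof -
    obtain i j where ij: "x = v ! i" "y = v ! j" "i < length v" "j < length v"
      using xy by (auto simp: in_set_conv_nth)
    have "(i, j) \<in> pattern G v \<longleftrightarrow> (i, j) \<in> pattern H w" using assms(4) by simp
    then show ?thesis using ij assms(3) g by (simp add: pattern_def)
  qed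
  have pat: "pattern H (map g u) = pattern G u" if "set u \<subseteq> set v" for u
    using adj that by (auto simp: pattern_def subset_iff)
  have "tree_list H (map g u)" if u: "set u \<subseteq> set v" "tree_list G u" for u
  proof -
    have "\<exists>j<i. adjacent H (map g u ! j) (map g u ! i)" if i: "i \<in> {0<..<length u}" for i
    proof -
      obtain j where "j < i" "adjacent G (u ! j) (u ! i)"
        using u(2) i unfolding tree_list_def by blast
      then show ?thesis
        using adj u(1) i by (intro exI[of _ j]) (auto simp: subset_iff)
    qed
    moreover have "inj_on g (set u)" using inj_on_subset[OF inj_g u(1)] .
    moreover have "g ` set u \<subseteq> univ H" using img u(1) dist(3) by blast
    ultimately show ?thesis using u(2) by (auto simp: tree_list_def distinct_map)
  qed
  then show thesis using that[OF inj_g img pat] by blast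
qed

text \<open>A common code provides an isomorphism from \<open>C\<close> to \<open>C'\<close> that
  carries the enumerations along injectively. Applied in both directions, this yields equality of
  the code sets and of the counts.\<close>

lemma
  assumes "t \<in> types G C" "t \<in> types H C'"
  shows types_subset: "types G C \<subseteq> types H C'"
    and card_tree_lists_type_le: "finite C' \<Longrightarrow> card {u. tree_list G u \<and> set u = C \<and> (length u, pattern G u) = s}
      \<le> card {u. tree_list H u \<and> set u = C' \<and> (length u, pattern H u) = s}"
proof -
  obtain v w where vw: "tree_list G v" "tree_list H w" "length v = length w" "pattern G v = pattern H w"
    and C: "C = set v" "C' = set w"
    using assms by (auto simp: types_def)
  obtain g where g: "inj_on g (set v)" "g ` set v = set w"
    "\<And>u. set u \<subseteq> set v \<Longrightarrow> pattern H (map g u) = pattern G u"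
    "\<And>u. set u \<subseteq> set v \<Longrightarrow> tree_list G u \<Longrightarrow> tree_list H (map g u)"
    using pattern_isoE[OF vw] by metis
  show "types G C \<subseteq> types H C'"
  proof
    fix s assume "s \<in> types G C"
    then obtain u where "tree_list G u" "set u = set v" "s = (length u, pattern G u)"
      by (auto simp: types_def C)
    then show "s \<in> types H C'"
      using g(2) g(3,4)[of u] unfolding types_def C by (auto intro!: exI[of _ "map g u"])
  qed
  show "card {u. tree_list G u \<and> set u = C \<and> (length u, pattern G u) = s}
      \<le> card {u. tree_list H u \<and> set u = C' \<and> (length u, pattern H u) = s}"
    if "finite C'"
  proof (rule card_inj_on_le[of "map g"])
    have "inj_on g (\<Union> (set ` {u. tree_list G u \<and> set u = C \<and> (length u, pattern G u) = s}))"
      by (rule inj_on_subset[OF g(1)]) (auto simp: C)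
    then show "inj_on (map g) {u. tree_list G u \<and> set u = C \<and> (length u, pattern G u) = s}"
      by (rule inj_on_mapI)
    show "map g ` {u. tree_list G u \<and> set u = C \<and> (length u, pattern G u) = s}
        \<subseteq> {u. tree_list H u \<and> set u = C' \<and> (length u, pattern H u) = s}"
      using g(2-4) by (auto simp: C)
    show "finite {u. tree_list H u \<and> set u = C' \<and> (length u, pattern H u) = s}"
      by (rule rev_finite_subset[OF finite_lists_length_eq[OF that, of "fst s"]]) auto
  qed
qed

text \<open>The choice depends on the set of codes alone, so components with equal code sets receive
  the same code, even in different graphs.\<close>

definition type_of :: "'a graph \<Rightarrow> 'a set \<Rightarrow> nat \<times> (nat \<times> nat) set" where
  "type_of G C = (SOME t. t \<in> types G C)"

lemma type_of_in_types: "C \<in> components G \<Longrightarrow> type_of G C \<in> types G C"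
  unfolding type_of_def using types_nonempty by (metis some_in_eq)

lemma type_of_eq_iff:
  assumes "C \<in> components G" "C' \<in> components H"
  shows "type_of G C = type_of H C' \<longleftrightarrow> type_of H C' \<in> types G C"
proof
  assume "type_of G C = type_of H C'"
  then show "type_of H C' \<in> types G C" using type_of_in_types[OF assms(1)] by simp
next
  assume *: "type_of H C' \<in> types G C"
  have "types G C = types H C'"
    using types_subset[OF * type_of_in_types[OF assms(2)]] types_subset[OF type_of_in_types[OF assms(2)] *]
    by blast
  then show "type_of G C = type_of H C'" by (simp add: type_of_def)
qed

text \<open>Double counting of the closed tree lists with code \<open>t\<close>: each component of
  type \<open>t\<close> contributes the same positive number of them and every other component
  none.\<close>

lemma polynomial_fun_card_components:
  fixes A :: "nat \<Rightarrow> 'a graph"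
  assumes sp: "strongly_polynomial graph_sig A" and G: "\<And>n. is_graph (A n)"
    and deg: "\<And>n x. x \<in> univ (A n) \<Longrightarrow> vertex_degree (A n) x \<le> D"
  shows "polynomial_fun (\<lambda>n. of_nat (card {C \<in> components (A n). type_of (A n) C = t}))"
\<comment> \<open>A type that never occurs has count 0; otherwise one occurrence \<open>C0\<close>
  serves as the reference for the number \<open>a\<close> of enumerations.\<close>
proof (cases "\<exists>n. \<exists>C\<in>components (A n). type_of (A n) C = t")
  case False
  then have empty: "{C \<in> components (A n). type_of (A n) C = t} = {}" for n by blast
  show ?thesis unfolding empty by (rule polynomial_fun_const)
next
  case True
  then obtain n0 C0 where C0: "C0 \<in> components (A n0)" "t = type_of (A n0) C0" by blast
  obtain p E where t: "t = (p, E)" by fastforce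
  have fin: "finite (univ (A n))" for n using G by (simp add: is_graph_def is_struct_def)
  have comp_sub: "C \<subseteq> univ (A n)" if "C \<in> components (A n)" for C n
    using that by (auto simp: components_def tree_list_def)
  have fin_comp: "finite (components (A n))" for n
    by (rule finite_subset[of _ "Pow (univ (A n))"]) (use comp_sub fin in auto)
  have finC: "finite C" if "C \<in> components (A n)" for C n
    using finite_subset[OF comp_sub[OF that] fin] .
  define L where "L n C = {u. tree_list (A n) u \<and> set u = C \<and> (length u, pattern (A n) u) = t}" for n C
  define a where "a = card (L n0 C0)"
  have t0: "t \<in> types (A n0) C0" using C0 type_of_in_types by blast
  then obtain v where v: "v \<in> L n0 C0" by (auto simp: types_def L_def)
  have pE: "0 < p" "E \<subseteq> {..<p} \<times> {..<p}"
    using v by (auto simp: L_def t tree_list_def pattern_def)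
  have finL: "finite (L n C)" if "C \<in> components (A n)" for n C
    by (rule rev_finite_subset[OF finite_lists_length_eq[OF finC[OF that], of p]]) (auto simp: L_def t)
  have "a > 0" using v finL[OF C0(1)] by (auto simp: a_def card_gt_0_iff)
  \<comment> \<open>A component with an enumeration of code \<open>t\<close> shares that code with
    \<open>C0\<close>, hence has type \<open>t\<close> and exactly as many such
    enumerations.\<close>
  have card_L: "card (L n C) = (if type_of (A n) C = t then a else 0)" if C: "C \<in> components (A n)" for n C
  proof (cases "t \<in> types (A n) C")
    case True
    have "card (L n C) = a"
      unfolding L_def a_def
      using card_tree_lists_type_le[OF True t0 finC[OF C0(1)], of t]
        card_tree_lists_type_le[OF t0 True finC[OF C], of t] by (rule le_antisym)
    then show ?thesis using True type_of_eq_iff[OF C C0(1)] C0(2) by simp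
  next
    case False
    then have "L n C = {}" by (auto simp: L_def types_def)
    then show ?thesis using False type_of_eq_iff[OF C C0(1)] C0(2) by simp
  qed
  have "card {v. tree_list (A n) v \<and> boundary (A n) (set v) = {} \<and> length v = p \<and> pattern (A n) v = E}
      = a * card {C \<in> components (A n). type_of (A n) C = t}" for n
  proof -
    have "{v. tree_list (A n) v \<and> boundary (A n) (set v) = {} \<and> length v = p \<and> pattern (A n) v = E}
        = (\<Union>C\<in>components (A n). L n C)"
      by (auto simp: L_def t components_def)
    then have "card {v. tree_list (A n) v \<and> boundary (A n) (set v) = {} \<and> length v = p \<and> pattern (A n) v = E}
        = (\<Sum>C\<in>components (A n). card (L n C))"
      using fin_comp finL by (simp only:) (intro card_UN_disjoint, auto simp: L_def)
    also have "\<dots> = (\<Sum>C\<in>components (A n). if type_of (A n) C = t then a else 0)"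
      using card_L by (intro sum.cong) auto
    also have "\<dots> = a * card {C \<in> components (A n). type_of (A n) C = t}"
      using fin_comp by (simp add: sum.If_cases Int_def mult.commute)
    finally show ?thesis .
  qed
  then have "(\<lambda>n. rat_of_nat (card {C \<in> components (A n). type_of (A n) C = t}))
      = (\<lambda>n. 1 / of_nat a * of_nat (card {v. tree_list (A n) v \<and> boundary (A n) (set v) = {} \<and>
            length v = p \<and> pattern (A n) v = E}))"
    using \<open>a > 0\<close> by simp
  then show ?thesis
    using polynomial_fun_mult[OF polynomial_fun_const
        polynomial_fun_card_closed_tree_lists[of A D, OF sp fin _ pE(2,1)]] deg
    by (simp only:)
qed

section \<open>Reassembling a graph from its components\<close>

definition pattern_graph :: "nat \<times> (nat \<times> nat) set \<Rightarrow> nat graph" where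
  "pattern_graph t = \<lparr>univ = {..<fst t}, rels = (\<lambda>_. {[i, j] | i j. (i, j) \<in> snd t})\<rparr>"

lemma adjacent_pattern_graph: "adjacent (pattern_graph t) i j \<longleftrightarrow> (i, j) \<in> snd t"
  by (simp add: adjacent_def pattern_graph_def)

lemma is_graph_pattern_graph:
  assumes "E \<subseteq> {..<p} \<times> {..<p}" "sym E" "irrefl E"
  shows "is_graph (pattern_graph (p, E))"
  using assms
  by (auto simp: is_graph_def adjacent_def is_struct_def pattern_graph_def graph_sig_def
      sym_def irrefl_def)

text \<open>The components partition the vertices and no edge joins two of them, so it suffices to
  identify each component with the pattern graph of its type.\<close>

lemma isomorphic_copies_of_components:
  assumes G: "is_graph G" and h: "inj_on h {..<k}"
    and types: "\<And>C. C \<in> components G \<Longrightarrow> type_of G C \<in> h ` {..<k}"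
  shows "isomorphic graph_sig G (disjoint_union {..<k}
    (\<lambda>i. copies (card {C \<in> components G. type_of G C = h i}) (pattern_graph (h i))))"
    (is "isomorphic _ _ ?D")
proof -
  let ?S = "\<lambda>i. {C \<in> components G. type_of G C = h i}"
  have "finite (univ G)" using G by (simp add: is_graph_def is_struct_def)
  then have "finite (components G)"
    by (intro finite_subset[of "components G" "Pow (univ G)"]) (auto simp: components_def tree_list_def)
  then have ex_e: "\<exists>f. bij_betw f {..<card (?S i)} (?S i)" for i
    using ex_bij_betw_nat_finite[of "?S i"] by (simp add: lessThan_atLeast0)
  \<comment> \<open>\<open>e i\<close> numbers the components of type \<open>h i\<close>, matching
    the numbering of the copies.\<close>
  define e where "e i = (SOME f. bij_betw f {..<card (?S i)} (?S i))" for i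
  have e: "bij_betw (e i) {..<card (?S i)} (?S i)" for i
    unfolding e_def by (rule someI_ex[OF ex_e])
  have "\<exists>v. tree_list G v \<and> set v = C \<and> type_of G C = (length v, pattern G v)" if "C \<in> components G" for C
    using type_of_in_types[OF that] unfolding types_def by auto
  \<comment> \<open>The enumeration of \<open>C\<close> is chosen to have the code
    \<open>type_of G C\<close>, so that positions in it are vertices of the pattern graph.\<close>
  then obtain enum where enum: "\<And>C. C \<in> components G \<Longrightarrow> tree_list G (enum C) \<and> set (enum C) = C \<and>
      type_of G C = (length (enum C), pattern G (enum C))" by metis
  define f where "f = (\<lambda>(i, c, x). enum (e i c) ! x)"
  have D: "univ ?D = {(i, c, x). i < k \<and> c < card (?S i) \<and> x < fst (h i)}"
    by (auto simp: disjoint_union_def copies_def pattern_graph_def)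
  have adjD: "adjacent ?D (i, c, x) (i', c', y) \<longleftrightarrow> i = i' \<and> c = c' \<and> (x, y) \<in> snd (h i)"
    if "i < k" "c < card (?S i)" for i c x i' c' y
    using that by (auto simp: adjacent_disjoint_union copies_def adjacent_pattern_graph)
  have e_mem: "e i c \<in> ?S i" if "c < card (?S i)" for i c
    using bij_betwE[OF e[of i]] that by blast
  have e_in: "e i c \<in> components G" "length (enum (e i c)) = fst (h i)" "pattern G (enum (e i c)) = snd (h i)"
    if "c < card (?S i)" for i c
  proof -
    note * = e_mem[OF that]
    then show "e i c \<in> components G" by blast
    then have "h i = (length (enum (e i c)), pattern G (enum (e i c)))"
      using enum[of "e i c"] * by simp
    then show "length (enum (e i c)) = fst (h i)" "pattern G (enum (e i c)) = snd (h i)"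
      by simp_all
  qed
  have f_in: "f (i, c, x) \<in> e i c" if "c < card (?S i)" "x < fst (h i)" for i c x
    using e_in[OF that(1)] enum[of "e i c"] that(2) nth_mem[of x "enum (e i c)"] by (auto simp: f_def)
  have e_inj: "i = i' \<and> c = c'"
    if "i < k" "i' < k" "c < card (?S i)" "c' < card (?S i')" "e i c = e i' c'" for i c i' c'
  proof -
    have "h i = h i'" using e_mem[OF that(3)] e_mem[OF that(4)] that(5) by simp
    then have "i = i'" using h that(1,2) by (auto simp: inj_on_def)
    then show ?thesis using e[of i] that(3-5) by (auto simp: bij_betw_def inj_on_def)
  qed
  have bij: "bij_betw f (univ ?D) (univ G)"
    unfolding bij_betw_def
  proof
    show "inj_on f (univ ?D)"
    proof (rule inj_onI)
      fix a b assume ab: "a \<in> univ ?D" "b \<in> univ ?D" "f a = f b"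
      obtain i c x i' c' y where [simp]: "a = (i, c, x)" "b = (i', c', y)" by (metis prod_cases3)
      have a: "i < k" "c < card (?S i)" "x < fst (h i)" and b: "i' < k" "c' < card (?S i')" "y < fst (h i')"
        using ab(1,2) by (simp_all add: D)
      \<comment> \<open>The common image lies in both components, which therefore coincide; the type
        then determines \<open>i\<close> and the numbering determines \<open>c\<close>.\<close>
      have "e i c = e i' c'"
        using components_eqI[OF G e_in(1)[OF a(2)] e_in(1)[OF b(2)] f_in[OF a(2,3)]] f_in[OF b(2,3)] ab(3)
        by simp
      then have [simp]: "i' = i" "c' = c" using e_inj[OF a(1) b(1) a(2) b(2)] by auto
      have "distinct (enum (e i c))" using enum[OF e_in(1)[OF a(2)]] by (simp add: tree_list_def)
      then have "x = y"
        using ab(3) a(3) b(3) e_in(2)[OF a(2)] by (simp add: f_def nth_eq_iff_index_eq)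
      then show "a = b" by simp
    qed
    show "f ` univ ?D = univ G"
    proof (intro equalityI subsetI)
      fix z assume "z \<in> f ` univ ?D"
      then obtain i c x where "c < card (?S i)" "x < fst (h i)" "z = f (i, c, x)" by (auto simp: D)
      then show "z \<in> univ G"
        using f_in[of c i x] e_in(1)[of c i] by (auto simp: components_def tree_list_def)
    next
      fix z assume "z \<in> univ G"
      then obtain C where C: "C \<in> components G" "z \<in> C" by (rule ex_component[OF G])
      obtain i where i: "i < k" "type_of G C = h i" using types[OF C(1)] by auto
      then have "C \<in> ?S i" using C(1) by simp
      then obtain c where c: "c < card (?S i)" "C = e i c"
        using e[of i] unfolding bij_betw_def by (metis (no_types, lifting) imageE lessThan_iff)
      obtain x where "x < length (enum C)" "z = enum C ! x"
        using C(2) enum[OF C(1)] by (metis in_set_conv_nth)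
      then have "(i, c, x) \<in> univ ?D" "z = f (i, c, x)"
        using i c e_in(2)[OF c(1)] by (auto simp: D f_def)
      then show "z \<in> f ` univ ?D" by blast
    qed
  qed
  have "adjacent ?D a b \<longleftrightarrow> adjacent G (f a) (f b)" if ab: "a \<in> univ ?D" "b \<in> univ ?D" for a b
  proof -
    obtain i c x i' c' y where ab_eq: "a = (i, c, x)" "b = (i', c', y)" by (metis prod_cases3)
    have a: "i < k" "c < card (?S i)" "x < fst (h i)" and b: "i' < k" "c' < card (?S i')" "y < fst (h i')"
      using ab by (simp_all add: D ab_eq)
    show ?thesis
    proof (cases "i' = i \<and> c' = c")
      case True
      have "adjacent G (f a) (f b) \<longleftrightarrow> (x, y) \<in> pattern G (enum (e i c))"
        using True a b e_in(2)[OF a(2)] by (simp add: ab_eq f_def pattern_def)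
      then show ?thesis using True e_in(3)[OF a(2)] adjD[OF a(1,2)] by (simp add: ab_eq)
    next
      case False
      \<comment> \<open>A component has empty boundary, so an edge leaving \<open>f a\<close> would
        put \<open>f b\<close> into the same component.\<close>
      have "\<not> adjacent G (f a) (f b)"
      proof
        assume adj: "adjacent G (f a) (f b)"
        have "boundary G (e i c) = {}" using e_in(1)[OF a(2)] by (auto simp: components_def)
        then have "f b \<in> e i c"
          using boundary_eq_emptyD[OF G _ _ adj] f_in[OF a(2,3)] by (simp add: ab_eq)
        then have "e i c = e i' c'"
          using components_eqI[OF G e_in(1)[OF a(2)] e_in(1)[OF b(2)]] f_in[OF b(2,3)] by (simp add: ab_eq)
        then show False using e_inj[OF a(1) b(1) a(2) b(2)] False by auto
      qed
      then show ?thesis using False adjD[OF a(1,2)] by (auto simp: ab_eq)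
    qed
  qed
  then have "isomorphic graph_sig ?D G" using bij by (intro isomorphic_graph_sig_I)
  then show ?thesis by (rule isomorphic_sym)
qed

lemma strongly_polynomial_imp_polynomial_disjoint_union:
  fixes A :: "nat \<Rightarrow> 'a graph"
  assumes G: "\<And>n. is_graph (A n)" and "bounded_degree_seq A" and sp: "strongly_polynomial graph_sig A"
  shows "polynomial_disjoint_union A"
proof -
  obtain D where deg: "\<And>n x. x \<in> univ (A n) \<Longrightarrow> vertex_degree (A n) x \<le> D"
    using assms(2) unfolding bounded_degree_seq_def by blast
  have fin: "finite (univ (A n))" for n using G by (simp add: is_graph_def is_struct_def)
  obtain K where K: "\<And>n v. tree_list (A n) v \<Longrightarrow> length v < K"
    using tree_list_length_bounded[of A D, OF sp fin deg] by blast
  \<comment> \<open>All conceivable codes with fewer than \<open>K\<close> vertices. Symmetry and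
    irreflexivity make each of them a graph; codes that never occur as a type get count 0.\<close>
  define T where "T = {(p, E) | p E. p < K \<and> E \<subseteq> {..<p} \<times> {..<p} \<and> sym E \<and> irrefl (E :: (nat \<times> nat) set)}"
  have "T \<subseteq> {..<K} \<times> Pow ({..<K} \<times> {..<K})"
  proof
    fix t assume "t \<in> T"
    then obtain p E where t: "t = (p, E)" "p < K" "E \<subseteq> {..<p} \<times> {..<p}" by (auto simp: T_def)
    then have "{..<p} \<times> {..<p} \<subseteq> {..<K} \<times> {..<K}" by auto
    then show "t \<in> {..<K} \<times> Pow ({..<K} \<times> {..<K})" using t by blast
  qed
  then have "finite T" by (rule finite_subset) simp
  then obtain h where h: "bij_betw h {..<card T} T"
    using ex_bij_betw_nat_finite[of T] by (auto simp: lessThan_atLeast0)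
  have types: "type_of (A n) C \<in> h ` {..<card T}" if C: "C \<in> components (A n)" for n C
  proof -
    obtain v where v: "tree_list (A n) v" "type_of (A n) C = (length v, pattern (A n) v)"
      using type_of_in_types[OF C] by (auto simp: types_def)
    have "sym (pattern (A n) v)" "irrefl (pattern (A n) v)"
      using G[of n] by (auto simp: pattern_def sym_def irrefl_def is_graph_def)
    then have "type_of (A n) C \<in> T"
      using v(2) K[OF v(1)] by (auto simp: T_def pattern_def)
    then show ?thesis using h by (simp add: bij_betw_def)
  qed
  define m where "m i n = card {C \<in> components (A n). type_of (A n) C = h i}" for i n
  have "\<exists>P. \<forall>n. of_nat (m i n) = poly P (of_nat n :: rat)" for i
    using polynomial_fun_card_components[of A D, OF sp G deg] by (simp add: m_def polynomial_fun_def)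
  then obtain P where P: "\<And>i n. of_nat (m i n) = poly (P i) (of_nat n :: rat)" by metis
  have "is_graph (pattern_graph (h i))" if "i < card T" for i
  proof -
    have "h i \<in> T" using h that by (auto simp: bij_betw_def)
    then show ?thesis by (auto simp: T_def intro: is_graph_pattern_graph)
  qed
  moreover have "isomorphic graph_sig (A n)
      (disjoint_union {..<card T} (\<lambda>i. copies (m i n) (pattern_graph (h i))))" for n
    unfolding m_def using isomorphic_copies_of_components[of "A n" h "card T"] G types h
    by (simp add: bij_betw_def)
  ultimately show ?thesis
    unfolding polynomial_disjoint_union_def using P
    by (intro exI[of _ "card T"] exI[of _ "\<lambda>i. pattern_graph (h i)"] exI[of _ P] exI[of _ m]) simp
qed

theorem theorem5p3:
  fixes A :: "nat \<Rightarrow> 'a graph"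
  assumes "\<And>n. is_graph (A n)"
    and "bounded_degree_seq A"
  shows "(strongly_polynomial graph_sig A \<longleftrightarrow> polynomial_disjoint_union A) \<and>
         (polynomial_disjoint_union A \<longleftrightarrow> qf_interpretation_of_basic_sequence A)"
  using strongly_polynomial_imp_polynomial_disjoint_union[OF assms]
    polynomial_disjoint_union_imp_qf_interpretation[of A]
    qf_interpretation_imp_strongly_polynomial[of A, OF assms(1)]
  by blast

end
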